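(* Let $\Omega$ be a slice domain in $\mathbb{H}$. Then (pointwise) addition $+$, the regular product $*$ and the regular conjugation $f\mapsto f^c$ are operations on the set of slice regular functions $\Omega\to\mathbb{H}$ and turn it into a real $^*$-algebra. Moreover, if $f,g:\Omega\to\mathbb{H}$ are slice regular functions, then the following properties hold: 1. if $f$ is slice preserving, then $(f*g)(q)=f(q)g(q)=(g*f)(q)$ for all $q\in\Omega$; 2. if $g$ is constantly equal to $c\in\mathbb{H}$, then $(f*g)(q)=f(q)c$ for all $q\in\Omega$; 3. $f^s$ is a slice preserving slice regular function and $f^s=f*f^c=f^c*f$.
   Context: $\mathbb{H}$ is the real algebra of quaternions, $\mathbb{S}=\{J\in\mathbb{H}:J^2=-1\}$, $L_I=\mathbb{R}+I\mathbb{R}$ and $T_I=T\cap L_I$ for $I\in\mathbb{S}$, $T\subseteq\mathbb{H}$. For $q=x+yI$ ($x,y\in\mathbb{R}$, $I\in\mathbb{S}$), $\operatorname{Re}(q)=x$ and $\operatorname{Im}(q)=yI$. A domain is a nonempty open connected set; a slice domain is a domain $\Omega\subseteq\mathbb{H}$ with $\Omega\cap\mathbb{R}\neq\emptyset$ such that $\Omega_I$ is a domain of $L_I$ for every $I\in\mathbb{S}$. A function $f:\Omega\to\mathbb{H}$ is slice regular if, for every $I\in\mathbb{S}$, the restriction $f_I$ of $f$ to $\Omega_I$ has continuous partial derivatives and $\frac12\left(\frac{\partial}{\partial x}+I\frac{\partial}{\partial y}\right)f_I(x+yI)\equiv0$. A slice regular $f$ is slice preserving if $f(\Omega_I)\subseteq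 L_I$ for all $I\in\mathbb{S}$. Spherical value and derivative: for a slice regular $f$ on a slice domain $\Omega$ and $p_0=x_0+y_0I_0\in\Omega\setminus\mathbb{R}$ ($y_0>0$, $I_0\in\mathbb{S}$), it is known that there exist a neighborhood $U\subseteq\Omega$ of $p_0$ in $x_0+y_0\mathbb{S}$ and unique quaternions $b(p_0),c(p_0)$ (independent of $U$) with $f(x_0+y_0I)=b(p_0)+I\,c(p_0)$ for all $x_0+y_0I\in U$. Set $f^\circ_s(p_0)=b(p_0)$ and $f'_s(p_0)=y_0^{-1}c(p_0)$; for $p_0\in\Omega\cap\mathbb{R}$ set $f^\circ_s(p_0)=f(p_0)$. Thus $f(q)=f^\circ_s(q)+\operatorname{Im}(q)f'_s(q)$ on $\Omega\setminus\mathbb{R}$. Operations: for $q\in\Omega\setminus\mathbb{R}$, $(f*g)(q)=f^\circ_s(q)g^\circ_s(q)+\operatorname{Im}(q)^2f'_s(q)g'_s(q)+\operatorname{Im}(q)\big(f^\circ_s(q)g'_s(q)+f'_s(q)g^\circ_s(q)\big)$, $f^c(q)=\overline{f^\circ_s(q)}+\operatorname{Im}(q)\overline{f'_s(q)}$, $f^s(q)=|f^\circ_s(q)|^2-|\operatorname{Im}(q)f'_s(q)|^2+2\operatorname{Im}(q)\operatorname{Re}\big(f^\circ_s(q)\overline{f'_s(q)}\big)$; for $q\in\Omega\cap\mathbb{R}$, $(f*g)(q)=f(q)g(q)$, $f^c(q)=\overline{f(q)}$, $f^s(q)=|f(q)|^2$. A real $^*$-algebra is an (associative, unital) real algebra with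 a real-linear involution $f\mapsto f^c$ such that $(f^c)^c=f$, $(f*g)^c=g^c*f^c$, and $f^c=f$ when $f$ is a real constant. *)

theory Defs
  imports "HOL-Analysis.Analysis" "HOL-Algebra.Module"
begin

section \<open>Quaternions\<close>

datatype quat = Quat (qre: real) (qi: real) (qj: real) (qk: real)

lemma quat_eqI: "qre p = qre q \<Longrightarrow> qi p = qi q \<Longrightarrow> qj p = qj q \<Longrightarrow> qk p = qk q \<Longrightarrow> p = q"
  by (cases p; cases q) auto

lemma quat_eq_iff: "p = q \<longleftrightarrow> qre p = qre q \<and> qi p = qi q \<and> qj p = qj q \<and> qk p = qk q"
  by (auto intro: quat_eqI)

instantiation quat :: ring_1
begin

definition zero_quat :: quat where "0 = Quat 0 0 0 0"

definition one_quat :: quat where "1 = Quat 1 0 0 0"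

definition plus_quat :: "quat \<Rightarrow> quat \<Rightarrow> quat" where
  "p + q = Quat (qre p + qre q) (qi p + qi q) (qj p + qj q) (qk p + qk q)"

definition uminus_quat :: "quat \<Rightarrow> quat" where
  "- p = Quat (- qre p) (- qi p) (- qj p) (- qk p)"

definition minus_quat :: "quat \<Rightarrow> quat \<Rightarrow> quat" where
  "p - q = Quat (qre p - qre q) (qi p - qi q) (qj p - qj q) (qk p - qk q)"

definition times_quat :: "quat \<Rightarrow> quat \<Rightarrow> quat" where
  "p * q = Quat
     (qre p * qre q - qi p * qi q - qj p * qj q - qk p * qk q)
     (qre p * qi q + qi p * qre q + qj p * qk q - qk p * qj q)
     (qre p * qj q - qi p * qk q + qj p * qre q + qk p * qi q)
     (qre p * qk q + qi p * qj q - qj p * qi q + qk p * qre q)"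

instance
  by standard
    (simp_all add: quat_eq_iff zero_quat_def one_quat_def plus_quat_def uminus_quat_def
      minus_quat_def times_quat_def algebra_simps)

end

lemma quat_sel_simps [simp]:
  "qre 0 = 0" "qi 0 = 0" "qj 0 = 0" "qk 0 = 0"
  "qre 1 = 1" "qi 1 = 0" "qj 1 = 0" "qk 1 = 0"
  "qre (p + q) = qre p + qre q" "qi (p + q) = qi p + qi q"
  "qj (p + q) = qj p + qj q" "qk (p + q) = qk p + qk q"
  "qre (- p) = - qre p" "qi (- p) = - qi p" "qj (- p) = - qj p" "qk (- p) = - qk p"
  "qre (p - q) = qre p - qre q" "qi (p - q) = qi p - qi q"
  "qj (p - q) = qj p - qj q" "qk (p - q) = qk p - qk q"
  "qre (p * q) = qre p * qre q - qi p * qi q - qj p * qj q - qk p * qk q"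
  "qi (p * q) = qre p * qi q + qi p * qre q + qj p * qk q - qk p * qj q"
  "qj (p * q) = qre p * qj q - qi p * qk q + qj p * qre q + qk p * qi q"
  "qk (p * q) = qre p * qk q + qi p * qj q - qj p * qi q + qk p * qre q"
  by (simp_all add: zero_quat_def one_quat_def plus_quat_def uminus_quat_def
      minus_quat_def times_quat_def)

instantiation quat :: real_algebra_1
begin

definition scaleR_quat :: "real \<Rightarrow> quat \<Rightarrow> quat" where
  "a *\<^sub>R q = Quat (a * qre q) (a * qi q) (a * qj q) (a * qk q)"

instance
  by standard (simp_all add: quat_eq_iff scaleR_quat_def algebra_simps)

end

lemma quat_sel_scaleR [simp]:
  "qre (a *\<^sub>R q) = a * qre q" "qi (a *\<^sub>R q) = a * qi q"
  "qj (a *\<^sub>R q) = a * qj q" "qk (a *\<^sub>R q) = a * qk q"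
  by (simp_all add: scaleR_quat_def)

lemma quat_sel_of_real [simp]:
  "qre (of_real a) = a" "qi (of_real a) = 0" "qj (of_real a) = 0" "qk (of_real a) = 0"
  by (simp_all add: of_real_def)

definition qconj :: "quat \<Rightarrow> quat" where
  "qconj q = Quat (qre q) (- qi q) (- qj q) (- qk q)"

text \<open>The Euclidean structure of \<open>\<real>\<^sup>4\<close>; it provides the norm and the topology.\<close>

instantiation quat :: real_inner
begin

definition inner_quat :: "quat \<Rightarrow> quat \<Rightarrow> real" where
  "inner_quat p q = qre p * qre q + qi p * qi q + qj p * qj q + qk p * qk q"

definition norm_quat :: "quat \<Rightarrow> real" where
  "norm_quat q = sqrt ((qre q)\<^sup>2 + (qi q)\<^sup>2 + (qj q)\<^sup>2 + (qk q)\<^sup>2)"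

definition sgn_quat :: "quat \<Rightarrow> quat" where
  "sgn_quat q = q /\<^sub>R norm q"

definition dist_quat :: "quat \<Rightarrow> quat \<Rightarrow> real" where
  "dist_quat p q = norm (p - q)"

definition uniformity_quat :: "(quat \<times> quat) filter" where
  "uniformity_quat = (INF e\<in>{0 <..}. principal {(x, y). dist x y < e})"

definition open_quat :: "quat set \<Rightarrow> bool" where
  "open_quat U \<longleftrightarrow> (\<forall>x\<in>U. eventually (\<lambda>(x', y). x' = x \<longrightarrow> y \<in> U) uniformity)"

instance
proof
  fix p q r :: quat and a :: real
  show "inner p q = inner q p" "inner (p + q) r = inner p r + inner q r"
    "inner (a *\<^sub>R p) q = a * inner p q"
    by (simp_all add: inner_quat_def algebra_simps)
  show "0 \<le> inner p p"
    by (simp add: inner_quat_def)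
  show "inner p p = 0 \<longleftrightarrow> p = 0"
    by (auto simp: inner_quat_def quat_eq_iff add_nonneg_eq_0_iff)
  show "norm p = sqrt (inner p p)"
    by (simp add: inner_quat_def norm_quat_def power2_eq_square)
qed (auto simp: sgn_quat_def dist_quat_def uniformity_quat_def open_quat_def)

end

instantiation quat :: real_normed_div_algebra
begin

definition inverse_quat :: "quat \<Rightarrow> quat" where
  "inverse_quat q = qconj q /\<^sub>R (norm q)\<^sup>2"

definition divide_quat :: "quat \<Rightarrow> quat \<Rightarrow> quat" where
  "divide_quat p q = p * inverse q"

instance
proof
  fix p q :: quat
  have conj: "qconj p * p = of_real ((norm p)\<^sup>2)" "p * qconj p = of_real ((norm p)\<^sup>2)" for p
    by (simp_all add: quat_eq_iff qconj_def norm_quat_def algebra_simps power2_eq_square)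
  show "p \<noteq> 0 \<Longrightarrow> inverse p * p = 1" "p \<noteq> 0 \<Longrightarrow> p * inverse p = 1"
    by (simp_all add: inverse_quat_def conj del: of_real_power)
      (simp_all add: of_real_def)
  show "p div q = p * inverse q"
    by (simp add: divide_quat_def)
  show "inverse (0::quat) = 0"
    by (simp add: inverse_quat_def qconj_def quat_eq_iff)
  show "norm (p * q) = norm p * norm q"
  proof -
    have "qconj (p * q) = qconj q * qconj p"
      by (simp add: quat_eq_iff qconj_def)
    then have "of_real ((norm (p * q))\<^sup>2) = p * (q * qconj q) * qconj p"
      using conj(2)[of "p * q"] by (simp only: mult.assoc)
    also have "\<dots> = of_real ((norm q)\<^sup>2) * (p * qconj p)"
      by (simp add: conj(2) of_real_def)
    also have "\<dots> = of_real ((norm p * norm q)\<^sup>2)"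
      by (simp only: conj(2) of_real_mult[symmetric] power_mult_distrib mult.commute)
    finally have "(norm (p * q))\<^sup>2 = (norm p * norm q)\<^sup>2"
      by (simp only: of_real_eq_iff)
    moreover have "0 \<le> norm (p * q)" "0 \<le> norm p * norm q"
      by (simp_all add: norm_quat_def)
    ultimately show ?thesis
      using power2_eq_iff_nonneg by blast
  qed
qed

end

instantiation quat :: euclidean_space
begin

definition Basis_quat :: "quat set" where
  "Basis_quat = {Quat 1 0 0 0, Quat 0 1 0 0, Quat 0 0 1 0, Quat 0 0 0 1}"

instance
proof
  fix u v x :: quat
  show "(Basis :: quat set) \<noteq> {}" "finite (Basis :: quat set)"
    by (simp_all add: Basis_quat_def)
  show "inner u v = (if u = v then 1 else 0)" if "u \<in> Basis" "v \<in> Basis"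
    using that unfolding Basis_quat_def inner_quat_def by (elim insertE emptyE) simp_all
  show "(\<forall>u\<in>Basis. inner x u = 0) \<longleftrightarrow> x = 0"
    unfolding Basis_quat_def inner_quat_def quat_eq_iff[of x] by simp
qed

end

definition qim :: "quat \<Rightarrow> quat" where
  "qim q = q - of_real (qre q)"

definition imag_units :: "quat set" where
  "imag_units = {J. J\<^sup>2 = -1}"

definition cslice :: "quat \<Rightarrow> quat set" where
  "cslice I = {of_real x + y *\<^sub>R I |x y. True}"

section \<open>Slice regular functions\<close>

definition slice_domain :: "quat set \<Rightarrow> bool" where
  "slice_domain \<Omega> \<longleftrightarrow>
     \<Omega> \<noteq> {} \<and> open \<Omega> \<and> connected \<Omega> \<and> \<Omega> \<inter> \<real> \<noteq> {} \<and>
     (\<forall>I\<in>imag_units.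
        \<Omega> \<inter> cslice I \<noteq> {} \<and>
        openin (top_of_set (cslice I)) (\<Omega> \<inter> cslice I) \<and>
        connected (\<Omega> \<inter> cslice I))"

text \<open>Functions \<open>\<Omega> \<rightarrow> quat\<close> are total functions of which only the values on \<open>\<Omega>\<close> matter.
  In the next definition, \<open>fx\<close> and \<open>fy\<close> are the partial derivatives of
  \<open>(x, y) \<mapsto> f (x + y I)\<close>; since \<open>\<Omega>\<close> is open, the unrestricted filters \<open>at x\<close> and
  \<open>at y\<close> only involve values of \<open>f\<close> on \<open>\<Omega>\<close>.\<close>

definition slice_regular :: "quat set \<Rightarrow> (quat \<Rightarrow> quat) \<Rightarrow> bool" where
  "slice_regular \<Omega> f \<longleftrightarrow>
     (\<forall>I\<in>imag_units. \<exists>fx fy :: real \<Rightarrow> real \<Rightarrow> quat.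
        (\<forall>x y. of_real x + y *\<^sub>R I \<in> \<Omega> \<longrightarrow>
           ((\<lambda>s. f (of_real s + y *\<^sub>R I)) has_vector_derivative fx x y) (at x) \<and>
           ((\<lambda>t. f (of_real x + t *\<^sub>R I)) has_vector_derivative fy x y) (at y) \<and>
           (1/2) *\<^sub>R (fx x y + I * fy x y) = 0) \<and>
        continuous_on {(x, y). of_real x + y *\<^sub>R I \<in> \<Omega>} (\<lambda>(x, y). fx x y) \<and>
        continuous_on {(x, y). of_real x + y *\<^sub>R I \<in> \<Omega>} (\<lambda>(x, y). fy x y))"

definition slice_preserving :: "quat set \<Rightarrow> (quat \<Rightarrow> quat) \<Rightarrow> bool" where
  "slice_preserving \<Omega> f \<longleftrightarrow> (\<forall>I\<in>imag_units. f ` (\<Omega> \<inter> cslice I) \<subseteq> cslice I)"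

section \<open>Spherical value and spherical derivative\<close>

text \<open>The sphere \<open>x\<^sub>0 + y\<^sub>0 \<S>\<close> through \<open>p = x\<^sub>0 + y\<^sub>0 I\<^sub>0\<close>, where \<open>y\<^sub>0 = |Im p|\<close>.\<close>

definition qsphere :: "quat \<Rightarrow> quat set" where
  "qsphere p = {of_real (qre p) + norm (qim p) *\<^sub>R I |I. I \<in> imag_units}"

definition spherical_coeffs :: "quat set \<Rightarrow> (quat \<Rightarrow> quat) \<Rightarrow> quat \<Rightarrow> quat \<Rightarrow> quat \<Rightarrow> bool" where
  "spherical_coeffs \<Omega> f p b c \<longleftrightarrow>
     (\<exists>U. openin (top_of_set (qsphere p)) U \<and> p \<in> U \<and> U \<subseteq> \<Omega> \<and>
        (\<forall>I\<in>imag_units. of_real (qre p) + norm (qim p) *\<^sub>R I \<in> U \<longrightarrow>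
           f (of_real (qre p) + norm (qim p) *\<^sub>R I) = b + I * c))"

text \<open>For slice regular \<open>f\<close> and non-real \<open>p \<in> \<Omega>\<close> the coefficients exist and are unique;
  this is not asserted here.\<close>

definition spherical_value :: "quat set \<Rightarrow> (quat \<Rightarrow> quat) \<Rightarrow> quat \<Rightarrow> quat" where
  "spherical_value \<Omega> f p =
     (if p \<in> \<real> then f p else (THE b. \<exists>c. spherical_coeffs \<Omega> f p b c))"

text \<open>Only meaningful at non-real points.\<close>

definition spherical_deriv :: "quat set \<Rightarrow> (quat \<Rightarrow> quat) \<Rightarrow> quat \<Rightarrow> quat" where
  "spherical_deriv \<Omega> f p =
     (THE c. \<exists>b. spherical_coeffs \<Omega> f p b c) /\<^sub>R norm (qim p)"

section \<open>Operations on slice regular functions\<close>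

definition reg_mult :: "quat set \<Rightarrow> (quat \<Rightarrow> quat) \<Rightarrow> (quat \<Rightarrow> quat) \<Rightarrow> quat \<Rightarrow> quat" where
  "reg_mult \<Omega> f g = (\<lambda>q\<in>\<Omega>.
     if q \<in> \<real> then f q * g q
     else spherical_value \<Omega> f q * spherical_value \<Omega> g q
        + (qim q)\<^sup>2 * spherical_deriv \<Omega> f q * spherical_deriv \<Omega> g q
        + qim q * (spherical_value \<Omega> f q * spherical_deriv \<Omega> g q
                 + spherical_deriv \<Omega> f q * spherical_value \<Omega> g q))"

definition reg_conj :: "quat set \<Rightarrow> (quat \<Rightarrow> quat) \<Rightarrow> quat \<Rightarrow> quat" where
  "reg_conj \<Omega> f = (\<lambda>q\<in>\<Omega>.
     if q \<in> \<real> then qconj (f q)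
     else qconj (spherical_value \<Omega> f q) + qim q * qconj (spherical_deriv \<Omega> f q))"

definition symmetrization :: "quat set \<Rightarrow> (quat \<Rightarrow> quat) \<Rightarrow> quat \<Rightarrow> quat" where
  "symmetrization \<Omega> f = (\<lambda>q\<in>\<Omega>.
     if q \<in> \<real> then of_real ((norm (f q))\<^sup>2)
     else of_real ((norm (spherical_value \<Omega> f q))\<^sup>2)
        - of_real ((norm (qim q * spherical_deriv \<Omega> f q))\<^sup>2)
        + 2 * qim q * of_real (qre (spherical_value \<Omega> f q * qconj (spherical_deriv \<Omega> f q))))"

section \<open>Real star-algebras\<close>

definition real_ring :: "real ring" where
  "real_ring = \<lparr>carrier = UNIV, monoid.mult = (*), one = 1, ring.zero = 0, add = (+)\<rparr>"

text \<open>The library's locale \<open>algebra\<close> is restricted to commutative algebras. The real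
  constants of \<open>A\<close> are the real multiples of its unit.\<close>

locale real_star_algebra =
  fixes A :: "(real, 'a) module" (structure)
    and conj :: "'a \<Rightarrow> 'a"
  assumes ring: "ring A"
    and module: "module real_ring A"
    and smult_mult_left: "\<lbrakk>x \<in> carrier A; y \<in> carrier A\<rbrakk> \<Longrightarrow> (a \<odot> x) \<otimes> y = a \<odot> (x \<otimes> y)"
    and smult_mult_right: "\<lbrakk>x \<in> carrier A; y \<in> carrier A\<rbrakk> \<Longrightarrow> x \<otimes> (a \<odot> y) = a \<odot> (x \<otimes> y)"
    and conj_closed: "x \<in> carrier A \<Longrightarrow> conj x \<in> carrier A"
    and conj_add: "\<lbrakk>x \<in> carrier A; y \<in> carrier A\<rbrakk> \<Longrightarrow> conj (x \<oplus> y) = conj x \<oplus> conj y"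
    and conj_smult: "x \<in> carrier A \<Longrightarrow> conj (a \<odot> x) = a \<odot> conj x"
    and conj_conj: "x \<in> carrier A \<Longrightarrow> conj (conj x) = x"
    and conj_mult: "\<lbrakk>x \<in> carrier A; y \<in> carrier A\<rbrakk> \<Longrightarrow> conj (x \<otimes> y) = conj y \<otimes> conj x"
    and conj_real: "conj (a \<odot> \<one>) = a \<odot> \<one>"

text \<open>A function on \<open>\<Omega>\<close> is represented by its extensional representative, so that equality
  in the carrier is equality on \<open>\<Omega>\<close>.\<close>

definition slice_regular_algebra :: "quat set \<Rightarrow> (real, quat \<Rightarrow> quat) module" where
  "slice_regular_algebra \<Omega> =
     \<lparr>carrier = {f \<in> extensional \<Omega>. slice_regular \<Omega> f},
      monoid.mult = reg_mult \<Omega>,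
      one = (\<lambda>q\<in>\<Omega>. 1),
      ring.zero = (\<lambda>q\<in>\<Omega>. 0),
      add = (\<lambda>f g. \<lambda>q\<in>\<Omega>. f q + g q),
      smult = (\<lambda>a f. \<lambda>q\<in>\<Omega>. a *\<^sub>R f q)\<rparr>"

end

theory Submission
  imports Defs "HOL-Complex_Analysis.Conformal_Mappings"
begin

text \<open>
  Write \<open>z \<mapsto> Re z + Im z I\<close> for the parametrization of the slice \<open>L\<^sub>I\<close>. A function is slice regular
  exactly when, composed with each of these, it is holomorphic for the complex structure given by
  left multiplication by \<open>I\<close> (\<open>slice_regular_iff\<close>). Complex-linear functionals reduce such maps to
  ordinary holomorphic functions, so the identity principle holds: since each slice of a slice domain
  is connected and contains the real points of the domain, a slice regular function is determined by
  its values on the real axis (\<open>slice_regular_identity\<close>). On the real axis the regular product,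
  the regular conjugation and the symmetrization are the pointwise operations of the quaternions.
  Hence the algebra axioms and the identities for slice preserving functions, constants and the
  symmetrization all reduce to identities in the quaternions, once both sides of each are known to
  be slice regular.

  That the operations preserve slice regularity is the analytic part. Near each point of the
  domain there is a local stem: \<open>f (x + y I) = b (x, y) + I c (x, y)\<close> for all \<open>I\<close> near a given unit,
  with \<open>b\<close> and \<open>c\<close> independent of \<open>I\<close> and \<open>b + i c\<close> holomorphic for a central \<open>i\<close>
  (\<open>slice_regular_stem_rep\<close>). To find it, join the point to a real point by a path inside its slice;
  a thickening of the path lies in the domain on all nearby slices. Interpolate \<open>f\<close> on two of these
  slices by \<open>b + I c\<close>. On every other nearby slice \<open>f\<close> and \<open>b + I c\<close> agree on real points, so the
  identity principle makes them equal. The stem yields the spherical value and the spherical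
  derivative, \<open>b\<close> and \<open>c / y\<close> (\<open>stem_rep_spherical\<close>), and turns the regular operations into the
  product and the conjugation of quaternion-valued holomorphic pairs, which satisfy the
  Cauchy--Riemann equations again.
\<close>

section \<open>Quaternionic conjugation and imaginary units\<close>

lemma qconj_sel [simp]:
  "qre (qconj q) = qre q" "qi (qconj q) = - qi q" "qj (qconj q) = - qj q" "qk (qconj q) = - qk q"
  by (simp_all add: qconj_def)

lemma bounded_linear_qconj: "bounded_linear qconj"
  by (rule linear_conv_bounded_linear[THEN iffD1], rule linearI) (auto simp: quat_eq_iff)

lemma qconj_simps [simp]:
  "qconj (p + q) = qconj p + qconj q" "qconj (p - q) = qconj p - qconj q"
  "qconj (a *\<^sub>R p) = a *\<^sub>R qconj p" "qconj (qconj p) = p" "qconj 0 = 0" "qconj (of_real a) = of_real a"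
  by (auto simp: quat_eq_iff)

lemma qconj_mult: "qconj (p * q) = qconj q * qconj p"
  by (auto simp: quat_eq_iff)

lemma mult_qconj_self: "q * qconj q = of_real ((norm q)\<^sup>2)" "qconj q * q = of_real ((norm q)\<^sup>2)"
  by (simp_all add: quat_eq_iff norm_quat_def power2_eq_square algebra_simps)

lemma Reals_quat_commute: "(p::quat) \<in> \<real> \<Longrightarrow> p * q = q * p"
  by (auto simp: Reals_def of_real_def)

lemma imag_unit_mult: "I \<in> imag_units \<Longrightarrow> I * I = -1"
  by (simp add: imag_units_def power2_eq_square)

lemma imag_unit_mult_left: "I \<in> imag_units \<Longrightarrow> I * (I * q) = - q"
  by (metis imag_unit_mult mult.assoc mult_minus1)

lemma imag_unit_iff: "I \<in> imag_units \<longleftrightarrow> qre I = 0 \<and> norm I = 1"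
proof
  assume "I \<in> imag_units"
  then have eq: "I * I = -1" by (rule imag_unit_mult)
  then have e: "qre I * qre I - qi I * qi I - qj I * qj I - qk I * qk I = -1"
      "qre I * qi I = 0" "qre I * qj I = 0" "qre I * qk I = 0"
    by (auto simp: quat_eq_iff)
  have "qre I = 0"
  proof (rule ccontr)
    assume "qre I \<noteq> 0"
    with e have "qre I * qre I = -1" by auto
    then show False
      by (smt (verit) zero_le_square)
  qed
  moreover have "norm I = 1"
    using e \<open>qre I = 0\<close> by (simp add: norm_quat_def power2_eq_square)
  ultimately show "qre I = 0 \<and> norm I = 1" by simp
next
  assume "qre I = 0 \<and> norm I = 1"
  then show "I \<in> imag_units"
    by (auto simp: imag_units_def power2_eq_square quat_eq_iff norm_quat_def)
qed

lemma uminus_imag_unit [simp]: "- I \<in> imag_units \<longleftrightarrow> I \<in> imag_units"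
  by (simp add: imag_units_def power2_eq_square)

lemma imag_units_not_isolated:
  assumes I: "I \<in> imag_units" and "open V" "I \<in> V"
  obtains K where "K \<in> imag_units" "K \<in> V" "K \<noteq> I"
proof -
  have "\<exists>q. q * I \<noteq> I * q"
  proof (rule ccontr)
    assume "\<not> ?thesis"
    then have "\<And>q. q * I = I * q" by blast
    from this[of "Quat 0 1 0 0"] this[of "Quat 0 0 1 0"]
    have "qi I = 0" "qj I = 0" "qk I = 0" by (auto simp: quat_eq_iff)
    then show False using I by (auto simp: imag_unit_iff norm_quat_def)
  qed
  then obtain q where q: "q * I \<noteq> I * q" by blast
  \<comment> \<open>Conjugates of \<open>I\<close> by invertible quaternions near \<open>1\<close> are imaginary units near \<open>I\<close>,
    and conjugation by \<open>1 + t q\<close> moves \<open>I\<close>.\<close>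
  define u where "u = (\<lambda>t. 1 + t *\<^sub>R q)"
  have "((\<lambda>t. 1 + t *\<^sub>R q) \<longlongrightarrow> 1 + 0 *\<^sub>R q) (at_right 0)"
    by (intro tendsto_intros)
  then have u1: "(u \<longlongrightarrow> 1) (at_right 0)" by (simp add: u_def)
  then have "((\<lambda>t. u t * I * inverse (u t)) \<longlongrightarrow> 1 * I * inverse 1) (at_right 0)"
    by (intro tendsto_intros) auto
  then have "eventually (\<lambda>t. u t * I * inverse (u t) \<in> V) (at_right 0)"
    using assms by (auto dest: topological_tendstoD)
  moreover have "eventually (\<lambda>t. u t \<noteq> 0) (at_right 0)"
    using u1 by (rule tendsto_imp_eventually_ne) simp
  moreover have "eventually (\<lambda>t::real. t > 0) (at_right 0)"
    by (rule eventually_at_right_less)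
  ultimately have "eventually (\<lambda>t. u t * I * inverse (u t) \<in> V \<and> u t \<noteq> 0 \<and> t > 0) (at_right 0)"
    by eventually_elim auto
  then obtain t where t: "u t * I * inverse (u t) \<in> V" "u t \<noteq> 0" "t > 0"
    using eventually_happens' trivial_limit_at_right_real by blast
  let ?K = "u t * I * inverse (u t)"
  have "?K * ?K = u t * (I * (inverse (u t) * u t) * I) * inverse (u t)"
    by (simp only: mult.assoc)
  also have "\<dots> = -1" using t imag_unit_mult[OF I] by simp
  finally have "?K \<in> imag_units" by (simp add: imag_units_def power2_eq_square)
  moreover have "?K \<noteq> I"
  proof
    assume "?K = I"
    then have "?K * u t = I * u t" by simp
    then have "u t * I = I * u t" using t by (simp add: mult.assoc)
    then have "q * I = I * q" using t by (simp add: u_def algebra_simps)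
    with q show False ..
  qed
  ultimately show ?thesis using t that by blast
qed

section \<open>Complex coordinates on the slices\<close>

text \<open>The parametrization \<open>z \<mapsto> Re z + Im z I\<close> of the slice \<open>L\<^sub>I\<close> by the complex plane. All
  slices are parametrized by the same plane, and the real axis is fixed pointwise.\<close>

definition slice_emb :: "quat \<Rightarrow> complex \<Rightarrow> quat" where
  "slice_emb I z = of_real (Re z) + Im z *\<^sub>R I"

lemma slice_emb_of_real [simp]: "slice_emb I (of_real x) = of_real x"
  by (simp add: slice_emb_def)

lemma slice_emb_mult: "slice_emb I h * d = Re h *\<^sub>R d + Im h *\<^sub>R (I * d)"
  by (simp add: slice_emb_def algebra_simps scaleR_conv_of_real)

lemma continuous_on_slice_emb [continuous_intros]:
  "continuous_on S f \<Longrightarrow> continuous_on S g \<Longrightarrow> continuous_on S (\<lambda>x. slice_emb (f x) (g x))"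
  unfolding slice_emb_def by (intro continuous_intros)

lemma open_slice_emb_vimage: "open \<Omega> \<Longrightarrow> open (slice_emb I -` \<Omega>)"
  by (intro open_vimage continuous_intros)

lemma slice_emb_components:
  assumes "I \<in> imag_units"
  shows "qre (slice_emb I z) = Re z" "qim (slice_emb I z) = Im z *\<^sub>R I"
    "norm (qim (slice_emb I z)) = \<bar>Im z\<bar>"
  using assms by (simp_all add: slice_emb_def qim_def imag_unit_iff)

lemma slice_emb_real_iff:
  assumes "I \<in> imag_units"
  shows "slice_emb I z \<in> \<real> \<longleftrightarrow> Im z = 0"
proof
  assume "slice_emb I z \<in> \<real>"
  then have "qim (slice_emb I z) = 0" by (auto simp: Reals_def qim_def)
  then show "Im z = 0" using slice_emb_components(3)[OF assms, of z] by simp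
qed (simp add: slice_emb_def)

lemma slice_emb_cases:
  obtains I z where "I \<in> imag_units" "q = slice_emb I z" "Im z \<ge> 0"
proof (cases "qim q = 0")
  case True
  then have "q = slice_emb (Quat 0 1 0 0) (of_real (qre q))" by (simp add: qim_def)
  moreover have "Quat 0 1 0 0 \<in> imag_units" by (simp add: imag_unit_iff norm_quat_def)
  ultimately show thesis using that[of "Quat 0 1 0 0" "of_real (qre q)"] by simp
next
  case False
  define I where "I = qim q /\<^sub>R norm (qim q)"
  have "I \<in> imag_units" using False by (simp add: imag_unit_iff I_def qim_def)
  moreover have "q = slice_emb I (Complex (qre q) (norm (qim q)))"
    using False by (simp add: slice_emb_def I_def) (simp add: qim_def)
  ultimately show thesis using that[of I "Complex (qre q) (norm (qim q))"] by simp
qed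

lemma slice_emb_in_cslice [simp]: "slice_emb I z \<in> cslice I"
  by (auto simp: cslice_def slice_emb_def)

lemma cslice_commute: "p \<in> cslice I \<Longrightarrow> q \<in> cslice I \<Longrightarrow> p * q = q * p"
  unfolding cslice_def by (auto simp: algebra_simps of_real_def)

section \<open>Holomorphic maps on a slice\<close>

text \<open>Holomorphy of a map from the complex plane into the quaternions, regarded as a complex
  vector space in which the imaginary unit acts as left multiplication by \<open>I\<close>: the real derivative
  is \<open>h \<mapsto> (Re h + Im h I) d\<close> for some quaternion \<open>d\<close>.\<close>

definition slice_hol :: "quat \<Rightarrow> complex set \<Rightarrow> (complex \<Rightarrow> quat) \<Rightarrow> bool" where
  "slice_hol I D F \<longleftrightarrow>
     (\<forall>z\<in>D. \<exists>d. (F has_derivative (\<lambda>h. slice_emb I h * d)) (at z))"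

lemma slice_hol_subset: "slice_hol I D F \<Longrightarrow> E \<subseteq> D \<Longrightarrow> slice_hol I E F"
  unfolding slice_hol_def by blast

lemma slice_hol_add:
  assumes "slice_hol I D F" "slice_hol I D G"
  shows "slice_hol I D (\<lambda>z. F z + G z)"
  unfolding slice_hol_def
proof
  fix z assume "z \<in> D"
  then obtain p q where "(F has_derivative (\<lambda>h. slice_emb I h * p)) (at z)"
      "(G has_derivative (\<lambda>h. slice_emb I h * q)) (at z)"
    using assms unfolding slice_hol_def by blast
  from has_derivative_add[OF this]
  show "\<exists>d. ((\<lambda>z. F z + G z) has_derivative (\<lambda>h. slice_emb I h * d)) (at z)"
    by (auto simp: distrib_left[symmetric])
qed

lemma slice_hol_mult_right:
  assumes "slice_hol I D F"
  shows "slice_hol I D (\<lambda>z. F z * a)"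
  unfolding slice_hol_def
proof
  fix z assume "z \<in> D"
  then obtain p where "(F has_derivative (\<lambda>h. slice_emb I h * p)) (at z)"
    using assms unfolding slice_hol_def by blast
  from has_derivative_mult_left[OF this, of a]
  show "\<exists>d. ((\<lambda>z. F z * a) has_derivative (\<lambda>h. slice_emb I h * d)) (at z)"
    by (auto simp: mult.assoc)
qed

lemma slice_hol_const: "slice_hol I D (\<lambda>z. a)"
  unfolding slice_hol_def by (auto intro!: exI[of _ 0])

lemma slice_hol_diff:
  assumes "slice_hol I D F" "slice_hol I D G"
  shows "slice_hol I D (\<lambda>z. F z - G z)"
  using slice_hol_add[OF assms(1) slice_hol_mult_right[OF assms(2), of "-1"]] by simp

lemma slice_hol_cong:
  assumes "open D" "\<And>z. z \<in> D \<Longrightarrow> F z = G z"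
  shows "slice_hol I D F \<longleftrightarrow> slice_hol I D G"
proof -
  have "(F has_derivative F') (at z) \<longleftrightarrow> (G has_derivative F') (at z)" if "z \<in> D" for z F'
    using has_derivative_transform_within_open[of F F' z UNIV D G]
      has_derivative_transform_within_open[of G F' z UNIV D F] assms that by auto
  then show ?thesis by (simp add: slice_hol_def)
qed

text \<open>The pointwise product is holomorphic only because the left factor commutes with \<open>I\<close>.\<close>

lemma slice_hol_mult:
  assumes "slice_hol I D F" "slice_hol I D G" and F: "\<And>z. z \<in> D \<Longrightarrow> F z \<in> cslice I"
  shows "slice_hol I D (\<lambda>z. F z * G z)"
  unfolding slice_hol_def
proof
  fix z assume z: "z \<in> D"
  then obtain p q where "(F has_derivative (\<lambda>h. slice_emb I h * p)) (at z)"
      "(G has_derivative (\<lambda>h. slice_emb I h * q)) (at z)"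
    using assms unfolding slice_hol_def by blast
  from has_derivative_mult[OF this]
  have "((\<lambda>z. F z * G z) has_derivative
      (\<lambda>h. F z * (slice_emb I h * q) + slice_emb I h * p * G z)) (at z)" .
  also have "(\<lambda>h. F z * (slice_emb I h * q) + slice_emb I h * p * G z)
      = (\<lambda>h. slice_emb I h * (F z * q + p * G z))"
  proof
    fix h
    have "F z * (slice_emb I h * q) = slice_emb I h * (F z * q)"
      unfolding mult.assoc[symmetric] using cslice_commute[OF F[OF z] slice_emb_in_cslice] by simp
    then show "F z * (slice_emb I h * q) + slice_emb I h * p * G z = slice_emb I h * (F z * q + p * G z)"
      by (simp add: distrib_left mult.assoc)
  qed
  finally show "\<exists>d. ((\<lambda>z. F z * G z) has_derivative (\<lambda>h. slice_emb I h * d)) (at z)" ..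
qed

text \<open>The functional \<open>q \<mapsto> \<langle>q, w\<rangle> - i \<langle>I q, w\<rangle>\<close>. It is linear over the complex numbers
  when \<open>i\<close> acts on quaternions as left multiplication by \<open>I\<close>, so it carries
  \<^const>\<open>slice_hol\<close> maps to holomorphic functions; its real part is \<open>\<langle>q, w\<rangle>\<close>.\<close>

definition slice_functional :: "quat \<Rightarrow> quat \<Rightarrow> quat \<Rightarrow> complex" where
  "slice_functional I w q = Complex (inner q w) (- inner (I * q) w)"

lemma slice_functional_emb:
  assumes "I \<in> imag_units"
  shows "slice_functional I w (slice_emb I h * d) = slice_functional I w d * h"
  using imag_unit_mult_left[OF assms, of d]
  by (simp add: slice_functional_def slice_emb_mult complex_eq_iff algebra_simps inner_simps)

lemma slice_functional_field_derivative:
  assumes "I \<in> imag_units" and F: "(F has_derivative (\<lambda>h. slice_emb I h * d)) (at z)"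
  shows "((\<lambda>z. slice_functional I w (F z)) has_field_derivative slice_functional I w d) (at z)"
proof -
  have "linear (slice_functional I w)"
    by (rule linearI) (simp_all add: slice_functional_def complex_eq_iff algebra_simps inner_simps)
  then have "bounded_linear (slice_functional I w)"
    by (rule linear_conv_bounded_linear[THEN iffD1])
  from bounded_linear.has_derivative[OF this F] show ?thesis
    unfolding has_field_derivative_def using slice_functional_emb[OF assms(1)] by simp
qed

lemma slice_functional_holomorphic:
  assumes "I \<in> imag_units" and "slice_hol I D F"
  shows "(\<lambda>z. slice_functional I w (F z)) holomorphic_on D"
  unfolding holomorphic_on_def field_differentiable_def
proof
  fix z assume "z \<in> D"
  then obtain d where "(F has_derivative (\<lambda>h. slice_emb I h * d)) (at z)"
    using assms(2) unfolding slice_hol_def by blast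
  then show "\<exists>f'. ((\<lambda>z. slice_functional I w (F z)) has_field_derivative f') (at z within D)"
    using slice_functional_field_derivative[OF assms(1)] has_field_derivative_at_within by blast
qed

lemma slice_hol_identity:
  assumes I: "I \<in> imag_units" and D: "open D" "connected D" and hol: "slice_hol I D F"
    and r: "complex_of_real r \<in> D"
    and zero: "\<And>x. complex_of_real x \<in> D \<Longrightarrow> F (of_real x) = 0"
    and z: "z \<in> D"
  shows "F z = 0"
proof -
  have lim: "complex_of_real r islimpt (D \<inter> \<real>)"
  proof (rule islimptI)
    fix T assume T: "complex_of_real r \<in> T" "open T"
    have "open (complex_of_real -` (D \<inter> T))"
      using D T by (intro open_vimage continuous_intros) auto
    then obtain e where e: "e > 0" "ball r e \<subseteq> complex_of_real -` (D \<inter> T)"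
      using r T by (metis IntI open_contains_ball vimageI)
    have "r + e/2 \<in> ball r e" using e by (simp add: dist_real_def)
    with e have "complex_of_real (r + e/2) \<in> D \<inter> T" by blast
    with e show "\<exists>y\<in>D \<inter> \<real>. y \<in> T \<and> y \<noteq> complex_of_real r"
      by (intro bexI[of _ "complex_of_real (r + e/2)"]) auto
  qed
  have *: "slice_functional I w (F z) = 0" for w
  proof (rule analytic_continuation[OF slice_functional_holomorphic[OF I hol] D _ r lim _ z])
    show "slice_functional I w (F z) = 0" if "z \<in> D \<inter> \<real>" for z
      using that zero by (auto simp: Reals_def slice_functional_def zero_complex.code complex_eq_iff)
  qed auto
  have "inner (F z) (F z) = 0"
    using *[of "F z"] by (simp add: slice_functional_def complex_eq_iff)
  then show ?thesis by simp
qed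

section \<open>Slice regularity as holomorphy on each slice\<close>

lemma slice_regular_imp_slice_hol:
  assumes "open \<Omega>" and reg: "slice_regular \<Omega> f" and I: "I \<in> imag_units"
  shows "slice_hol I (slice_emb I -` \<Omega>) (\<lambda>z. f (slice_emb I z))"
  unfolding slice_hol_def
proof
  fix z assume "z \<in> slice_emb I -` \<Omega>"
  define x y where "x = Re z" and "y = Im z"
  let ?D = "{(x, y). of_real x + y *\<^sub>R I \<in> \<Omega>}"
  obtain fx fy :: "real \<Rightarrow> real \<Rightarrow> quat" where
    fx: "\<And>x y. (x, y) \<in> ?D \<Longrightarrow> ((\<lambda>s. f (of_real s + y *\<^sub>R I)) has_vector_derivative fx x y) (at x)"
    and fy: "\<And>x y. (x, y) \<in> ?D \<Longrightarrow> ((\<lambda>t. f (of_real x + t *\<^sub>R I)) has_vector_derivative fy x y) (at y)"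
    and cr: "\<And>x y. (x, y) \<in> ?D \<Longrightarrow> (1/2) *\<^sub>R (fx x y + I * fy x y) = 0"
    and cfy: "continuous_on ?D (\<lambda>(x, y). fy x y)"
    using reg I unfolding slice_regular_def by blast
  have xy: "(x, y) \<in> ?D"
    using \<open>z \<in> _\<close> by (simp add: slice_emb_def x_def y_def)
  have "open ((\<lambda>p. of_real (fst p) + snd p *\<^sub>R I) -` \<Omega>)"
    using \<open>open \<Omega>\<close> by (intro open_vimage continuous_intros)
  also have "((\<lambda>p. of_real (fst p) + snd p *\<^sub>R I) -` \<Omega>) = ?D" by auto
  finally have "open ?D" .
  then obtain A B where AB: "open A" "open B" "x \<in> A" "y \<in> B" "A \<times> B \<subseteq> ?D"
    using xy by (rule open_prod_elim) auto
  obtain e where e: "e > 0" "ball y e \<subseteq> B"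
    using AB open_contains_ball by blast
  have sub: "A \<times> ball y e \<subseteq> ?D" using AB e by blast
  let ?f' = "\<lambda>x y. blinfun_scaleR_left (fy x y)"
  \<comment> \<open>Continuity of the partial derivatives gives total differentiability.\<close>
  have "((\<lambda>(x, y). f (of_real x + y *\<^sub>R I)) has_derivative
      (\<lambda>(tx, ty). (tx *\<^sub>R fx x y) + ?f' x y ty)) (at (x, y) within A \<times> ball y e)"
  proof (rule has_derivative_partialsI[where fy = "?f'"])
    show "((\<lambda>x. f (of_real x + y *\<^sub>R I)) has_derivative (\<lambda>tx. tx *\<^sub>R fx x y)) (at x within A)"
      using fx[OF xy] unfolding has_vector_derivative_def by (rule has_derivative_at_withinI)
    show "((\<lambda>y. f (of_real u + y *\<^sub>R I)) has_derivative blinfun_apply (?f' u v)) (at v within ball y e)"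
      if "u \<in> A" "v \<in> ball y e" for u v
    proof -
      have "(u, v) \<in> ?D" using that sub by blast
      from fy[OF this] show ?thesis
        unfolding has_vector_derivative_def
        by (auto intro: has_derivative_at_withinI simp: blinfun_scaleR_left.rep_eq)
    qed
    have "continuous (at (x, y) within A \<times> ball y e) (\<lambda>(x, y). fy x y)"
      using cfy xy sub
      by (metis (no_types, lifting) continuous_on_eq_continuous_within continuous_within_subset)
    then show "continuous (at (x, y) within A \<times> ball y e) (\<lambda>(x, y). ?f' x y)"
      unfolding case_prod_beta
      by (intro bounded_linear.continuous[OF bounded_linear_blinfun_scaleR_left])
  qed (use e in auto)
  also have "at (x, y) within A \<times> ball y e = at (x, y)"
    using AB e by (intro at_within_open open_Times) auto
  finally have "((\<lambda>(x, y). f (of_real x + y *\<^sub>R I)) has_derivative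
      (\<lambda>(tx, ty). (tx *\<^sub>R fx x y) + ?f' x y ty)) (at ((\<lambda>z. (Re z, Im z)) z))"
    by (simp add: x_def y_def)
  moreover have "((\<lambda>z. (Re z, Im z)) has_derivative (\<lambda>h. (Re h, Im h))) (at z)"
    by (auto intro!: derivative_eq_intros)
  ultimately have "((\<lambda>(x, y). f (of_real x + y *\<^sub>R I)) \<circ> (\<lambda>z. (Re z, Im z)) has_derivative
      (\<lambda>(tx, ty). (tx *\<^sub>R fx x y) + ?f' x y ty) \<circ> (\<lambda>h. (Re h, Im h))) (at z)"
    by (rule diff_chain_at[rotated])
  moreover have "fy x y = I * fx x y"
  proof -
    have "fx x y = - (I * fy x y)"
      using cr[OF xy] by (simp add: eq_neg_iff_add_eq_0)
    then have "I * fx x y = - (I * (I * fy x y))" by simp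
    then show ?thesis using imag_unit_mult_left[OF I, of "fy x y"] by simp
  qed
  ultimately have "((\<lambda>z. f (slice_emb I z)) has_derivative (\<lambda>h. slice_emb I h * fx x y)) (at z)"
    by (simp add: o_def slice_emb_def blinfun_scaleR_left.rep_eq algebra_simps scaleR_conv_of_real)
  then show "\<exists>d. ((\<lambda>z. f (slice_emb I z)) has_derivative (\<lambda>h. slice_emb I h * d)) (at z)" ..
qed

lemma slice_hol_imp_slice_regular:
  assumes "open \<Omega>" and I: "I \<in> imag_units"
  assumes hol: "slice_hol I (slice_emb I -` \<Omega>) (\<lambda>z. f (slice_emb I z))"
  shows "\<exists>fx fy :: real \<Rightarrow> real \<Rightarrow> quat.
        (\<forall>x y. of_real x + y *\<^sub>R I \<in> \<Omega> \<longrightarrow>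
           ((\<lambda>s. f (of_real s + y *\<^sub>R I)) has_vector_derivative fx x y) (at x) \<and>
           ((\<lambda>t. f (of_real x + t *\<^sub>R I)) has_vector_derivative fy x y) (at y) \<and>
           (1/2) *\<^sub>R (fx x y + I * fy x y) = 0) \<and>
        continuous_on {(x, y). of_real x + y *\<^sub>R I \<in> \<Omega>} (\<lambda>(x, y). fx x y) \<and>
        continuous_on {(x, y). of_real x + y *\<^sub>R I \<in> \<Omega>} (\<lambda>(x, y). fy x y)"
proof -
  let ?D = "slice_emb I -` \<Omega>" and ?F = "\<lambda>z. f (slice_emb I z)"
  let ?P = "{(x, y). of_real x + y *\<^sub>R I \<in> \<Omega>}"
  obtain d where d: "\<And>z. z \<in> ?D \<Longrightarrow> (?F has_derivative (\<lambda>h. slice_emb I h * d z)) (at z)"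
    using hol unfolding slice_hol_def by metis
  \<comment> \<open>The components of \<open>d\<close> are real parts of derivatives of holomorphic functions.\<close>
  have "continuous_on ?D d"
  proof (subst continuous_on_componentwise, intro ballI)
    fix w :: quat
    have holw: "(\<lambda>z. slice_functional I w (?F z)) holomorphic_on ?D"
      by (rule slice_functional_holomorphic[OF I hol])
    have "continuous_on ?D (\<lambda>z. Re (deriv (\<lambda>z. slice_functional I w (?F z)) z))"
      using holomorphic_deriv[OF holw open_slice_emb_vimage[OF \<open>open \<Omega>\<close>]]
      by (intro continuous_intros holomorphic_on_imp_continuous_on)
    also have "?this \<longleftrightarrow> continuous_on ?D (\<lambda>z. inner (d z) w)"
    proof (rule continuous_on_cong[OF refl])
      fix z assume "z \<in> ?D"
      show "Re (deriv (\<lambda>z. slice_functional I w (?F z)) z) = inner (d z) w"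
        using DERIV_imp_deriv[OF slice_functional_field_derivative[OF I d[OF \<open>z \<in> ?D\<close>], of w]]
        by (simp add: slice_functional_def)
    qed
    finally show "continuous_on ?D (\<lambda>z. inner (d z) w)" .
  qed
  then have "continuous_on ?P (d \<circ> (\<lambda>(x, y). Complex x y))"
    unfolding Complex_eq case_prod_beta
    by (intro continuous_on_compose continuous_intros)
      (auto elim!: continuous_on_subset simp: slice_emb_def)
  then have cont: "continuous_on ?P (\<lambda>(x, y). d (Complex x y))"
    by (simp add: o_def case_prod_beta)
  have contI: "continuous_on ?P (\<lambda>(x, y). I * d (Complex x y))"
    using continuous_on_mult_left[OF cont, of I] by (simp add: case_prod_beta)
  have partials: "((\<lambda>s. f (of_real s + y *\<^sub>R I)) has_vector_derivative d (Complex x y)) (at x)"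
       "((\<lambda>t. f (of_real x + t *\<^sub>R I)) has_vector_derivative I * d (Complex x y)) (at y)"
    if "of_real x + y *\<^sub>R I \<in> \<Omega>" for x y
  proof -
    have *: "(?F has_derivative (\<lambda>h. slice_emb I h * d (Complex x y))) (at (Complex x y))"
      by (rule d) (use that in \<open>simp add: slice_emb_def\<close>)
    have eq1: "at (Complex x y) = at (of_real x + Complex 0 y)"
      and eq2: "at (Complex x y) = at (Complex x 0 + y *\<^sub>R \<i>)"
      by (rule arg_cong[where f = at], simp add: complex_eq_iff)+
    have "((\<lambda>s. of_real s + Complex 0 y) has_derivative of_real) (at x)"
      by (auto intro!: derivative_eq_intros)
    from diff_chain_at[OF this, of ?F "\<lambda>h. slice_emb I h * d (Complex x y)"] *[unfolded eq1]
    show "((\<lambda>s. f (of_real s + y *\<^sub>R I)) has_vector_derivative d (Complex x y)) (at x)"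
      by (simp add: has_vector_derivative_def o_def slice_emb_def scaleR_conv_of_real complex_of_real_def)
    have "((\<lambda>t. Complex x 0 + t *\<^sub>R \<i>) has_derivative (\<lambda>t. t *\<^sub>R \<i>)) (at y)"
      by (auto intro!: derivative_eq_intros)
    from diff_chain_at[OF this, of ?F "\<lambda>h. slice_emb I h * d (Complex x y)"] *[unfolded eq2]
    show "((\<lambda>t. f (of_real x + t *\<^sub>R I)) has_vector_derivative I * d (Complex x y)) (at y)"
      by (simp add: has_vector_derivative_def o_def slice_emb_def Complex_eq mult.commute)
  qed
  show ?thesis
    using cont contI partials imag_unit_mult_left[OF I]
    by (intro exI[of _ "\<lambda>x y. d (Complex x y)"] exI[of _ "\<lambda>x y. I * d (Complex x y)"]) auto
qed

text \<open>Slice regularity asks for continuous partial derivatives, holomorphy only for a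
  derivative at each point; they agree because the derivative of a holomorphic function is
  continuous.\<close>

lemma slice_regular_iff:
  assumes "open \<Omega>"
  shows "slice_regular \<Omega> f \<longleftrightarrow>
    (\<forall>I\<in>imag_units. slice_hol I (slice_emb I -` \<Omega>) (\<lambda>z. f (slice_emb I z)))"
proof
  assume "slice_regular \<Omega> f"
  then show "\<forall>I\<in>imag_units. slice_hol I (slice_emb I -` \<Omega>) (\<lambda>z. f (slice_emb I z))"
    using slice_regular_imp_slice_hol[OF assms] by blast
next
  assume hol: "\<forall>I\<in>imag_units. slice_hol I (slice_emb I -` \<Omega>) (\<lambda>z. f (slice_emb I z))"
  show "slice_regular \<Omega> f"
    unfolding slice_regular_def
    by (intro ballI slice_hol_imp_slice_regular[OF assms] bspec[OF hol])
qed

lemma slice_regular_cong: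
  assumes "open \<Omega>" and eq: "\<And>q. q \<in> \<Omega> \<Longrightarrow> f q = g q"
  shows "slice_regular \<Omega> f \<longleftrightarrow> slice_regular \<Omega> g"
proof -
  have "slice_hol I (slice_emb I -` \<Omega>) (\<lambda>z. f (slice_emb I z)) \<longleftrightarrow>
        slice_hol I (slice_emb I -` \<Omega>) (\<lambda>z. g (slice_emb I z))" for I
    using eq by (intro slice_hol_cong open_slice_emb_vimage assms(1)) simp
  then show ?thesis by (simp add: slice_regular_iff[OF assms(1)])
qed

lemma slice_regular_restrict:
  "open \<Omega> \<Longrightarrow> slice_regular \<Omega> (restrict f \<Omega>) \<longleftrightarrow> slice_regular \<Omega> f"
  by (rule slice_regular_cong) auto

lemma slice_regular_add:
  "open \<Omega> \<Longrightarrow> slice_regular \<Omega> f \<Longrightarrow> slice_regular \<Omega> g \<Longrightarrow> slice_regular \<Omega> (\<lambda>q. f q + g q)"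
  by (simp add: slice_regular_iff slice_hol_add)

lemma slice_regular_mult_right:
  "open \<Omega> \<Longrightarrow> slice_regular \<Omega> f \<Longrightarrow> slice_regular \<Omega> (\<lambda>q. f q * a)"
  by (simp add: slice_regular_iff slice_hol_mult_right)

lemma slice_regular_scaleR:
  assumes "open \<Omega>" "slice_regular \<Omega> f"
  shows "slice_regular \<Omega> (\<lambda>q. a *\<^sub>R f q)"
  using slice_regular_mult_right[OF assms, of "of_real a"] by (simp add: of_real_def)

lemma slice_regular_const: "open \<Omega> \<Longrightarrow> slice_regular \<Omega> (\<lambda>q. a)"
  by (simp add: slice_regular_iff slice_hol_const)

text \<open>A real point lies in every slice, and two different slices \<open>L\<^sub>i\<close> and \<open>L\<^sub>j\<close> meet only in the
  real line.\<close>

lemma slice_preserving_real: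
  assumes "slice_preserving \<Omega> f" "of_real x \<in> \<Omega>"
  shows "f (of_real x) \<in> \<real>"
proof -
  have "f (of_real x) \<in> cslice I" if "I \<in> imag_units" for I
    using assms that slice_emb_in_cslice[of I "of_real x"] unfolding slice_preserving_def by auto
  moreover have "Quat 0 1 0 0 \<in> imag_units" "Quat 0 0 1 0 \<in> imag_units"
    by (simp_all add: imag_unit_iff norm_quat_def)
  ultimately have "f (of_real x) \<in> cslice (Quat 0 1 0 0)" "f (of_real x) \<in> cslice (Quat 0 0 1 0)"
    by blast+
  then have "f (of_real x) = of_real (qre (f (of_real x)))"
    unfolding cslice_def by (auto simp: quat_eq_iff)
  then show ?thesis by (metis Reals_of_real)
qed

lemma slice_regular_mult:
  assumes "open \<Omega>" "slice_regular \<Omega> f" "slice_regular \<Omega> g" "slice_preserving \<Omega> f"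
  shows "slice_regular \<Omega> (\<lambda>q. f q * g q)"
  unfolding slice_regular_iff[OF assms(1)]
proof
  fix I assume I: "I \<in> imag_units"
  have "f (slice_emb I z) \<in> cslice I" if "z \<in> slice_emb I -` \<Omega>" for z
    using assms(4) I that unfolding slice_preserving_def
    by (metis IntI image_subset_iff slice_emb_in_cslice vimageD)
  then show "slice_hol I (slice_emb I -` \<Omega>) (\<lambda>z. f (slice_emb I z) * g (slice_emb I z))"
    using assms(2,3) I by (intro slice_hol_mult) (simp_all add: slice_regular_iff[OF assms(1)])
qed

section \<open>Slice domains and the identity principle\<close>

lemma slice_domain_open: "slice_domain \<Omega> \<Longrightarrow> open \<Omega>"
  by (simp add: slice_domain_def)

lemma slice_domain_real_point:
  assumes "slice_domain \<Omega>"
  obtains r where "of_real r \<in> \<Omega>"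
  using assms unfolding slice_domain_def by (auto simp: Reals_def)

lemma slice_domain_slice_connected:
  assumes "slice_domain \<Omega>" and I: "I \<in> imag_units"
  shows "connected (slice_emb I -` \<Omega>)"
proof -
  let ?p = "\<lambda>q. Complex (inner q 1) (inner q I)"
  have II: "inner I I = 1" "inner I 1 = 0" "inner 1 I = 0" "inner (1::quat) 1 = 1"
    using I by (simp_all add: imag_unit_iff dot_square_norm inner_quat_def[of _ 1] inner_quat_def[of 1])
  have p: "?p (slice_emb I z) = z" for z
    using II by (simp add: slice_emb_def of_real_def inner_simps complex_eq_iff)
  have "slice_emb I -` \<Omega> = ?p ` (\<Omega> \<inter> cslice I)"
  proof (intro equalityI subsetI)
    fix z assume "z \<in> slice_emb I -` \<Omega>"
    then have "slice_emb I z \<in> \<Omega> \<inter> cslice I" by (auto simp: cslice_def slice_emb_def)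
    then show "z \<in> ?p ` (\<Omega> \<inter> cslice I)" by (rule rev_image_eqI) (rule p [symmetric])
  next
    fix z assume "z \<in> ?p ` (\<Omega> \<inter> cslice I)"
    then obtain x y where "of_real x + y *\<^sub>R I \<in> \<Omega>" "z = ?p (of_real x + y *\<^sub>R I)"
      by (auto simp: cslice_def)
    then show "z \<in> slice_emb I -` \<Omega>"
      using p[of "Complex x y"] by (simp add: slice_emb_def)
  qed
  moreover have "connected (?p ` (\<Omega> \<inter> cslice I))"
    using assms unfolding Complex_eq slice_domain_def
    by (intro connected_continuous_image continuous_intros) auto
  ultimately show ?thesis by simp
qed

text \<open>The identity principle: a slice regular function on a slice domain is determined by its
  values on the real points of the domain.\<close>

lemma slice_regular_identity:
  assumes \<Omega>: "slice_domain \<Omega>" and f: "slice_regular \<Omega> f" and g: "slice_regular \<Omega> g"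
    and eq: "\<And>x. of_real x \<in> \<Omega> \<Longrightarrow> f (of_real x) = g (of_real x)" and q: "q \<in> \<Omega>"
  shows "f q = g q"
proof -
  note op = slice_domain_open[OF \<Omega>]
  obtain I z where I: "I \<in> imag_units" and z: "q = slice_emb I z" by (rule slice_emb_cases)
  obtain r where r: "of_real r \<in> \<Omega>" using slice_domain_real_point[OF \<Omega>] .
  have "f (slice_emb I z) - g (slice_emb I z) = 0"
  proof (rule slice_hol_identity[OF I open_slice_emb_vimage[OF op] slice_domain_slice_connected[OF \<Omega> I]])
    show "slice_hol I (slice_emb I -` \<Omega>) (\<lambda>z. f (slice_emb I z) - g (slice_emb I z))"
      using f g I by (intro slice_hol_diff) (simp_all add: slice_regular_iff[OF op])
    show "complex_of_real r \<in> slice_emb I -` \<Omega>" using r by simp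
    show "z \<in> slice_emb I -` \<Omega>" using q z by simp
  qed (use eq in auto)
  then show ?thesis using z by simp
qed

lemma slice_regular_ext:
  assumes \<Omega>: "slice_domain \<Omega>" and "slice_regular \<Omega> f" "slice_regular \<Omega> g"
    and ext: "f \<in> extensional \<Omega>" "g \<in> extensional \<Omega>"
    and "\<And>x. of_real x \<in> \<Omega> \<Longrightarrow> f (of_real x) = g (of_real x)"
  shows "f = g"
  using ext by (rule extensionalityI) (rule slice_regular_identity[OF assms(1-3,6)])

text \<open>A point of a slice domain is joined to a real point by a path inside its slice. By
  compactness the same planar path, thickened, stays in the domain on all nearby slices.\<close>

lemma slice_tube:
  assumes \<Omega>: "slice_domain \<Omega>" and I: "I \<in> imag_units" and z: "slice_emb I z \<in> \<Omega>"
  obtains D V r where "open D" "connected D" "open V" "z \<in> D" "I \<in> V"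
    "complex_of_real r \<in> D" "\<And>w J. w \<in> D \<Longrightarrow> J \<in> V \<Longrightarrow> slice_emb J w \<in> \<Omega>"
proof -
  obtain r where r: "of_real r \<in> \<Omega>" using slice_domain_real_point[OF \<Omega>] .
  have "path_connected (slice_emb I -` \<Omega>)"
    using slice_domain_slice_connected[OF \<Omega> I] open_slice_emb_vimage[OF slice_domain_open[OF \<Omega>]]
    by (rule connected_open_path_connected[rotated])
  then obtain g where g: "path g" "path_image g \<subseteq> slice_emb I -` \<Omega>"
      "pathstart g = of_real r" "pathfinish g = z"
    using r z unfolding path_connected_def
    by (metis slice_emb_of_real vimageI)
  let ?K = "path_image g"
  \<comment> \<open>The compact set \<open>?K \<times> {I}\<close> has a uniform neighbourhood mapped into \<open>\<Omega>\<close>; by the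
    triangle inequality it contains products of balls of half its radius.\<close>
  have "open ((\<lambda>p. slice_emb (snd p) (fst p)) -` \<Omega>)"
    using slice_domain_open[OF \<Omega>] by (intro open_vimage continuous_intros)
  moreover have "compact (?K \<times> {I})"
    using g by (intro compact_Times compact_path_image) auto
  moreover have "?K \<times> {I} \<subseteq> (\<lambda>p. slice_emb (snd p) (fst p)) -` \<Omega>"
    using g by auto
  ultimately obtain e where e: "e > 0"
      "(\<Union>p\<in>?K \<times> {I}. ball p e) \<subseteq> (\<lambda>p. slice_emb (snd p) (fst p)) -` \<Omega>"
    using compact_subset_open_imp_ball_epsilon_subset
      [of "?K \<times> {I}" "(\<lambda>p. slice_emb (snd p) (fst p)) -` \<Omega>"] by metis
  define D where "D = (\<Union>w\<in>?K. ball w (e/2))"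
  have KD: "?K \<subseteq> D" using e by (auto simp: D_def)
  have "D = (\<lambda>p. fst p + snd p) ` (?K \<times> ball 0 (e/2))"
  proof (intro equalityI subsetI)
    fix w assume "w \<in> D"
    then obtain a where "a \<in> ?K" "dist a w < e/2" by (auto simp: D_def)
    then show "w \<in> (\<lambda>p. fst p + snd p) ` (?K \<times> ball 0 (e/2))"
      by (intro image_eqI[of _ _ "(a, w - a)"]) (auto simp: dist_norm norm_minus_commute)
  next
    fix w assume "w \<in> (\<lambda>p. fst p + snd p) ` (?K \<times> ball 0 (e/2))"
    then obtain a v where "a \<in> ?K" "v \<in> ball 0 (e/2)" "w = a + v" by auto
    then show "w \<in> D" unfolding D_def by (intro UN_I[of a]) (auto simp: dist_norm)
  qed
  moreover have "connected ((\<lambda>p. fst p + snd p) ` (?K \<times> ball 0 (e/2)))"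
    using g by (intro connected_continuous_image continuous_intros connected_Times connected_path_image) auto
  ultimately have "connected D" by simp
  show thesis
  proof
    show "open D" by (auto simp: D_def)
    show "connected D" by fact
    show "open (ball I (e/2))" by simp
    show "I \<in> ball I (e/2)" using e by simp
    show "z \<in> D" "complex_of_real r \<in> D"
      using KD g pathstart_in_path_image[of g] pathfinish_in_path_image[of g] by auto
    fix w J assume "w \<in> D" "J \<in> ball I (e/2)"
    then obtain a where a: "a \<in> ?K" "dist a w < e/2" "dist I J < e/2" by (auto simp: D_def)
    have "dist (a, I) (w, J) \<le> dist a w + dist I J"
      by (simp add: dist_Pair_Pair sqrt_sum_squares_le_sum)
    with a have "(w, J) \<in> ball (a, I) e" by simp
    moreover have "(a, I) \<in> ?K \<times> {I}" using a by simp
    ultimately have "(w, J) \<in> (\<lambda>p. slice_emb (snd p) (fst p)) -` \<Omega>" using e(2) by blast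
    then show "slice_emb J w \<in> \<Omega>" by simp
  qed
qed

section \<open>Local stems of slice regular functions\<close>

text \<open>The Cauchy--Riemann equations for a pair \<open>(b, c)\<close>, read as \<open>b + i c\<close> with an imaginary
  unit \<open>i\<close> that commutes with the quaternions: \<open>u + i v\<close> is the derivative.\<close>

definition stem_hol :: "complex set \<Rightarrow> (complex \<Rightarrow> quat) \<Rightarrow> (complex \<Rightarrow> quat) \<Rightarrow> bool" where
  "stem_hol D b c \<longleftrightarrow> (\<forall>z\<in>D. \<exists>u v.
     (b has_derivative (\<lambda>h. Re h *\<^sub>R u - Im h *\<^sub>R v)) (at z) \<and>
     (c has_derivative (\<lambda>h. Re h *\<^sub>R v + Im h *\<^sub>R u)) (at z))"

lemma stem_hol_imp_slice_hol:
  assumes "stem_hol D b c" and I: "I \<in> imag_units"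
  shows "slice_hol I D (\<lambda>z. b z + I * c z)"
  unfolding slice_hol_def
proof
  fix z assume "z \<in> D"
  then obtain u v where uv: "(b has_derivative (\<lambda>h. Re h *\<^sub>R u - Im h *\<^sub>R v)) (at z)"
     "(c has_derivative (\<lambda>h. Re h *\<^sub>R v + Im h *\<^sub>R u)) (at z)"
    using assms(1) unfolding stem_hol_def by blast
  have "((\<lambda>z. b z + I * c z) has_derivative
      (\<lambda>h. (Re h *\<^sub>R u - Im h *\<^sub>R v) + I * (Re h *\<^sub>R v + Im h *\<^sub>R u))) (at z)"
    by (intro has_derivative_add has_derivative_mult_right uv)
  also have "(\<lambda>h. (Re h *\<^sub>R u - Im h *\<^sub>R v) + I * (Re h *\<^sub>R v + Im h *\<^sub>R u))
      = (\<lambda>h. slice_emb I h * (u + I * v))"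
    using imag_unit_mult_left[OF I] by (simp add: slice_emb_mult algebra_simps fun_eq_iff)
  finally show "\<exists>d. ((\<lambda>z. b z + I * c z) has_derivative (\<lambda>h. slice_emb I h * d)) (at z)" ..
qed

lemma stem_hol_subset: "stem_hol D b c \<Longrightarrow> E \<subseteq> D \<Longrightarrow> stem_hol E b c"
  unfolding stem_hol_def by blast

text \<open>The product of \<open>b + i c\<close> and \<open>b' + i c'\<close>, with \<open>i\<close> central.\<close>

lemma stem_hol_mult:
  assumes "stem_hol D b c" "stem_hol D b' c'"
  shows "stem_hol D (\<lambda>z. b z * b' z - c z * c' z) (\<lambda>z. b z * c' z + c z * b' z)"
  unfolding stem_hol_def
proof
  fix z assume "z \<in> D"
  then obtain u v u' v' where d:
    "(b has_derivative (\<lambda>h. Re h *\<^sub>R u - Im h *\<^sub>R v)) (at z)"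
    "(c has_derivative (\<lambda>h. Re h *\<^sub>R v + Im h *\<^sub>R u)) (at z)"
    "(b' has_derivative (\<lambda>h. Re h *\<^sub>R u' - Im h *\<^sub>R v')) (at z)"
    "(c' has_derivative (\<lambda>h. Re h *\<^sub>R v' + Im h *\<^sub>R u')) (at z)"
    using assms unfolding stem_hol_def by meson
  define u'' where "u'' = b z * u' + u * b' z - c z * v' - v * c' z"
  define v'' where "v'' = b z * v' + v * b' z + c z * u' + u * c' z"
  have "((\<lambda>z. b z * b' z - c z * c' z) has_derivative (\<lambda>h. Re h *\<^sub>R u'' - Im h *\<^sub>R v'')) (at z)"
    by (rule has_derivative_eq_rhs, (rule has_derivative_diff has_derivative_mult d)+)
      (auto simp: fun_eq_iff u''_def v''_def algebra_simps)
  moreover have "((\<lambda>z. b z * c' z + c z * b' z) has_derivative (\<lambda>h. Re h *\<^sub>R v'' + Im h *\<^sub>R u'')) (at z)"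
    by (rule has_derivative_eq_rhs, (rule has_derivative_add has_derivative_mult d)+)
      (auto simp: fun_eq_iff u''_def v''_def algebra_simps)
  ultimately show "\<exists>u v.
      ((\<lambda>z. b z * b' z - c z * c' z) has_derivative (\<lambda>h. Re h *\<^sub>R u - Im h *\<^sub>R v)) (at z) \<and>
      ((\<lambda>z. b z * c' z + c z * b' z) has_derivative (\<lambda>h. Re h *\<^sub>R v + Im h *\<^sub>R u)) (at z)"
    by blast
qed

lemma stem_hol_qconj:
  assumes "stem_hol D b c"
  shows "stem_hol D (\<lambda>z. qconj (b z)) (\<lambda>z. qconj (c z))"
  unfolding stem_hol_def
proof
  fix z assume "z \<in> D"
  then obtain u v where d:
    "(b has_derivative (\<lambda>h. Re h *\<^sub>R u - Im h *\<^sub>R v)) (at z)"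
    "(c has_derivative (\<lambda>h. Re h *\<^sub>R v + Im h *\<^sub>R u)) (at z)"
    using assms unfolding stem_hol_def by blast
  from d[THEN bounded_linear.has_derivative[OF bounded_linear_qconj]]
  show "\<exists>u v. ((\<lambda>z. qconj (b z)) has_derivative (\<lambda>h. Re h *\<^sub>R u - Im h *\<^sub>R v)) (at z) \<and>
      ((\<lambda>z. qconj (c z)) has_derivative (\<lambda>h. Re h *\<^sub>R v + Im h *\<^sub>R u)) (at z)"
    by auto
qed

text \<open>Solving \<open>b + J c = F\<close> and \<open>b + K c = G\<close> for \<open>b\<close> and \<open>c\<close>.\<close>

lemma stem_hol_of_two_slices:
  assumes J: "J \<in> imag_units" and K: "K \<in> imag_units" and "J \<noteq> K"
    and F: "slice_hol J D F" and G: "slice_hol K D G"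
  defines "c \<equiv> \<lambda>z. inverse (J - K) * (F z - G z)"
  shows "stem_hol D (\<lambda>z. F z - J * c z) c"
  unfolding stem_hol_def
proof
  fix z assume "z \<in> D"
  then obtain p q where F': "(F has_derivative (\<lambda>h. slice_emb J h * p)) (at z)"
      and G': "(G has_derivative (\<lambda>h. slice_emb K h * q)) (at z)"
    using F G unfolding slice_hol_def by blast
  define v where "v = inverse (J - K) * (p - q)"
  define u where "u = p - J * v"
  have inv: "inverse (J - K) * ((J - K) * a) = a" "(J - K) * (inverse (J - K) * a) = a" for a
    using \<open>J \<noteq> K\<close> by (simp_all add: mult.assoc[symmetric])
  \<comment> \<open>The partial derivatives of \<open>c\<close> are \<open>v\<close> and \<open>u\<close>. That the formula for \<open>u\<close> agrees with
    \<open>(J - K)\<inverse> (J p - K q)\<close> rests on \<open>(J - K) J = - K (J - K)\<close>.\<close>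
  have "(J - K) * u = J * p - K * p - (J - K) * J * v"
    by (simp add: u_def algebra_simps)
  also have "(J - K) * J = - K * (J - K)"
    using imag_unit_mult[OF J] imag_unit_mult[OF K] by (simp add: algebra_simps)
  also have "- K * (J - K) * v = - K * (p - q)"
    unfolding v_def mult.assoc inv ..
  finally have Ju: "J * p - K * q = (J - K) * u" by (simp add: algebra_simps)
  have pv: "p - q = (J - K) * v" by (simp add: v_def inv)
  have "(c has_derivative (\<lambda>h. inverse (J - K) * (slice_emb J h * p - slice_emb K h * q))) (at z)"
    unfolding c_def by (intro has_derivative_mult_right has_derivative_diff F' G')
  also have "(\<lambda>h. inverse (J - K) * (slice_emb J h * p - slice_emb K h * q))
      = (\<lambda>h. Re h *\<^sub>R v + Im h *\<^sub>R u)"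
  proof
    fix h
    have "slice_emb J h * p - slice_emb K h * q = Re h *\<^sub>R (p - q) + Im h *\<^sub>R (J * p - K * q)"
      by (simp add: slice_emb_mult algebra_simps)
    also have "\<dots> = (J - K) * (Re h *\<^sub>R v + Im h *\<^sub>R u)"
      unfolding pv Ju by (simp add: distrib_left)
    finally show "inverse (J - K) * (slice_emb J h * p - slice_emb K h * q) = Re h *\<^sub>R v + Im h *\<^sub>R u"
      by (simp add: inv)
  qed
  finally have c': "(c has_derivative (\<lambda>h. Re h *\<^sub>R v + Im h *\<^sub>R u)) (at z)" .
  have "((\<lambda>z. F z - J * c z) has_derivative
      (\<lambda>h. slice_emb J h * p - J * (Re h *\<^sub>R v + Im h *\<^sub>R u))) (at z)"
    by (intro has_derivative_diff has_derivative_mult_right F' c')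
  also have "(\<lambda>h. slice_emb J h * p - J * (Re h *\<^sub>R v + Im h *\<^sub>R u)) = (\<lambda>h. Re h *\<^sub>R u - Im h *\<^sub>R v)"
    using imag_unit_mult_left[OF J] by (simp add: slice_emb_mult u_def algebra_simps fun_eq_iff)
  finally show "\<exists>u v. ((\<lambda>z. F z - J * c z) has_derivative (\<lambda>h. Re h *\<^sub>R u - Im h *\<^sub>R v)) (at z) \<and>
      (c has_derivative (\<lambda>h. Re h *\<^sub>R v + Im h *\<^sub>R u)) (at z)"
    using c' by blast
qed

text \<open>A local stem of \<open>f\<close>: on the slices of units in the open set \<open>V\<close> and over the open planar set
  \<open>D\<close>, the function is \<open>f (x + y I) = b (x, y) + I c (x, y)\<close>, where \<open>b\<close> and \<open>c\<close> do not depend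
  on \<open>I\<close>. Only the imaginary units in \<open>V\<close> matter. No symmetry of \<open>D\<close> or \<open>V\<close> under
  conjugation is required.\<close>

definition stem_rep ::
  "quat set \<Rightarrow> (quat \<Rightarrow> quat) \<Rightarrow> complex set \<Rightarrow> quat set \<Rightarrow> (complex \<Rightarrow> quat) \<Rightarrow> (complex \<Rightarrow> quat) \<Rightarrow> bool"
  where
  "stem_rep \<Omega> f D V b c \<longleftrightarrow> open D \<and> open V \<and> stem_hol D b c \<and>
     (\<forall>z\<in>D. \<forall>I\<in>V \<inter> imag_units. slice_emb I z \<in> \<Omega> \<and> f (slice_emb I z) = b z + I * c z)"

lemma stem_rep_apply:
  assumes "stem_rep \<Omega> f D V b c" "I \<in> imag_units" "I \<in> V" "z \<in> D"
  shows "slice_emb I z \<in> \<Omega>" "f (slice_emb I z) = b z + I * c z"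
  using assms unfolding stem_rep_def by blast+

lemma stem_rep_restrict:
  assumes "stem_rep \<Omega> f D V b c" "open E" "open W"
  shows "stem_rep \<Omega> f (D \<inter> E) (V \<inter> W) b c"
  using assms stem_hol_subset[of D b c "D \<inter> E"] unfolding stem_rep_def by auto

text \<open>Two different units in \<open>V\<close> give the same real point.\<close>

lemma stem_rep_zero_on_reals:
  assumes "stem_rep \<Omega> f D V b c" "I \<in> imag_units" "I \<in> V" "of_real x \<in> D"
  shows "c (of_real x) = 0"
proof -
  have "open V" using assms(1) by (simp add: stem_rep_def)
  then obtain K where K: "K \<in> imag_units" "K \<in> V" "K \<noteq> I"
    using imag_units_not_isolated assms by blast
  have "b (of_real x) + I * c (of_real x) = b (of_real x) + K * c (of_real x)"
    using assms K unfolding stem_rep_def by (metis IntI slice_emb_of_real)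
  then show ?thesis using K(3) by auto
qed

lemma stem_rep_real:
  assumes "stem_rep \<Omega> f D V b c" "I \<in> imag_units" "I \<in> V" "z \<in> D" "Im z = 0"
  shows "c z = 0" "f (slice_emb I z) = b z"
proof -
  have "z = of_real (Re z)" using assms(5) by (simp add: complex_eq_iff)
  then show "c z = 0" using stem_rep_zero_on_reals assms(1-4) by metis
  then show "f (slice_emb I z) = b z" using stem_rep_apply[OF assms(1-4)] by simp
qed

text \<open>The local representation formula. The stem is built from the values of \<open>f\<close> on two
  nearby slices; on any third slice the difference vanishes on real points, hence everywhere, by
  the identity principle.\<close>

lemma slice_regular_stem_rep:
  assumes \<Omega>: "slice_domain \<Omega>" and f: "slice_regular \<Omega> f"
    and I: "I \<in> imag_units" and z: "slice_emb I z \<in> \<Omega>"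
  obtains D V b c where "stem_rep \<Omega> f D V b c" "z \<in> D" "I \<in> V"
proof -
  obtain D V r where D: "open D" "connected D" and V: "open V" and zD: "z \<in> D" and IV: "I \<in> V"
    and r: "complex_of_real r \<in> D" and DV: "\<And>w J. w \<in> D \<Longrightarrow> J \<in> V \<Longrightarrow> slice_emb J w \<in> \<Omega>"
    using slice_tube[OF \<Omega> I z] by blast
  obtain K where K: "K \<in> imag_units" "K \<in> V" "K \<noteq> I"
    using imag_units_not_isolated[OF I V IV] by blast
  have hol: "slice_hol J D (\<lambda>w. f (slice_emb J w))" if J: "J \<in> imag_units" "J \<in> V" for J
  proof (rule slice_hol_subset)
    show "slice_hol J (slice_emb J -` \<Omega>) (\<lambda>w. f (slice_emb J w))"
      using f J slice_regular_iff[OF slice_domain_open[OF \<Omega>]] by blast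
    show "D \<subseteq> slice_emb J -` \<Omega>" using DV J by blast
  qed
  define c where "c = (\<lambda>w. inverse (I - K) * (f (slice_emb I w) - f (slice_emb K w)))"
  define b where "b = (\<lambda>w. f (slice_emb I w) - I * c w)"
  have stem: "stem_hol D b c"
    unfolding b_def c_def
    using K(3) by (intro stem_hol_of_two_slices I K hol IV) auto
  \<comment> \<open>On real points of \<open>D\<close> all slices meet, so \<open>c\<close> vanishes and \<open>b\<close> equals \<open>f\<close> there.\<close>
  have eq: "f (slice_emb J w) = b w + J * c w" if w: "w \<in> D" and J: "J \<in> V" "J \<in> imag_units" for w J
  proof -
    have "f (slice_emb J w) - (b w + J * c w) = 0"
    proof (rule slice_hol_identity[OF J(2) D slice_hol_diff r _ w])
      show "slice_hol J D (\<lambda>w. f (slice_emb J w))" using hol J by blast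
      show "slice_hol J D (\<lambda>w. b w + J * c w)" by (rule stem_hol_imp_slice_hol[OF stem J(2)])
      show "f (slice_emb J (of_real x)) - (b (of_real x) + J * c (of_real x)) = 0" for x
        by (simp add: b_def c_def)
    qed
    then show ?thesis by simp
  qed
  have "stem_rep \<Omega> f D V b c"
    unfolding stem_rep_def using D V stem eq DV by blast
  then show thesis using that zD IV by blast
qed

text \<open>Conversely, having a local stem at each point is enough for slice regularity.\<close>

lemma slice_regular_stemI:
  assumes "open \<Omega>"
    and rep: "\<And>I z. I \<in> imag_units \<Longrightarrow> slice_emb I z \<in> \<Omega> \<Longrightarrow>
      \<exists>D V b c. stem_rep \<Omega> f D V b c \<and> z \<in> D \<and> I \<in> V"
  shows "slice_regular \<Omega> f"
  unfolding slice_regular_iff[OF \<open>open \<Omega>\<close>]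
proof
  fix I assume I: "I \<in> imag_units"
  show "slice_hol I (slice_emb I -` \<Omega>) (\<lambda>z. f (slice_emb I z))"
    unfolding slice_hol_def
  proof
    fix z assume "z \<in> slice_emb I -` \<Omega>"
    then have "slice_emb I z \<in> \<Omega>" by simp
    from rep[OF I this] obtain D V b c where *: "stem_rep \<Omega> f D V b c" "z \<in> D" "I \<in> V"
      by (elim exE conjE)
    have "slice_hol I D (\<lambda>z. b z + I * c z)"
      using * I by (intro stem_hol_imp_slice_hol) (auto simp: stem_rep_def)
    moreover have "slice_hol I D (\<lambda>z. f (slice_emb I z)) \<longleftrightarrow> slice_hol I D (\<lambda>z. b z + I * c z)"
      using * I by (intro slice_hol_cong) (auto simp: stem_rep_def)
    ultimately show "\<exists>d. ((\<lambda>z. f (slice_emb I z)) has_derivative (\<lambda>h. slice_emb I h * d)) (at z)"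
      using * unfolding slice_hol_def by blast
  qed
qed

section \<open>Spherical value and spherical derivative\<close>

lemma spherical_coeffs_unique:
  assumes "p \<notin> \<real>" and "spherical_coeffs \<Omega> f p b c" and "spherical_coeffs \<Omega> f p b' c'"
  shows "b = b'" "c = c'"
proof -
  obtain I z where I: "I \<in> imag_units" and p: "p = slice_emb I z" and "Im z \<ge> 0"
    by (rule slice_emb_cases)
  with assms(1) have y: "Im z > 0" using slice_emb_real_iff[OF I, of z] by simp
  let ?s = "\<lambda>J. slice_emb J z"
  have s: "of_real (qre p) + norm (qim p) *\<^sub>R J = ?s J" for J
    unfolding p slice_emb_components(1,3)[OF I] using y by (simp add: slice_emb_def)
  have sphere: "qsphere p = ?s ` imag_units"
    unfolding qsphere_def s by auto
  obtain T T' where T: "open T" "p \<in> T" and T': "open T'" "p \<in> T'"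
    and eq: "\<And>J. J \<in> imag_units \<Longrightarrow> ?s J \<in> T \<Longrightarrow> f (?s J) = b + J * c"
    and eq': "\<And>J. J \<in> imag_units \<Longrightarrow> ?s J \<in> T' \<Longrightarrow> f (?s J) = b' + J * c'"
    using assms(2,3) unfolding spherical_coeffs_def s sphere openin_open by auto
  have "open (?s -` (T \<inter> T'))" using T T' by (intro open_vimage continuous_intros) auto
  moreover have "I \<in> ?s -` (T \<inter> T')" using T T' p by simp
  ultimately obtain K where K: "K \<in> imag_units" "?s K \<in> T" "?s K \<in> T'" "K \<noteq> I"
    using imag_units_not_isolated[OF I] by (metis IntD1 IntD2 vimageD)
  have 1: "b + I * c = b' + I * c'" using eq[OF I] eq'[OF I] T T' p by simp
  have 2: "b + K * c = b' + K * c'" using eq[OF K(1)] eq'[OF K(1)] K by simp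
  \<comment> \<open>An affine function \<open>J \<mapsto> b + J c\<close> is determined by its values at two units.\<close>
  have "(K - I) * (c - c') = (b + K * c) - (b' + K * c') - ((b + I * c) - (b' + I * c'))"
    by (simp add: algebra_simps)
  also have "\<dots> = 0" unfolding 1 2 by simp
  finally show "c = c'" using K by simp
  with 1 show "b = b'" by simp
qed

lemma stem_rep_spherical_coeffs:
  assumes rep: "stem_rep \<Omega> f D V b c" and I: "I \<in> imag_units" "I \<in> V" and z: "z \<in> D" "Im z \<noteq> 0"
  shows "spherical_coeffs \<Omega> f (slice_emb I z) (b z) (sgn (Im z) *\<^sub>R c z)"
proof -
  let ?p = "slice_emb I z" and ?x = "of_real (Re z) :: quat"
  let ?T = "(\<lambda>q. (q - ?x) /\<^sub>R Im z) -` V"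
  \<comment> \<open>The definition of spherical coefficients writes the sphere with \<open>\<bar>Im z\<bar>\<close>; for \<open>Im z < 0\<close> this
    replaces the unit \<open>J\<close> by \<open>- J\<close>.\<close>
  have sphere: "of_real (qre ?p) + norm (qim ?p) *\<^sub>R J = slice_emb (sgn (Im z) *\<^sub>R J) z" for J
    unfolding slice_emb_components(1,3)[OF I(1)] by (simp add: slice_emb_def abs_sgn)
  have sgn: "sgn (Im z) *\<^sub>R J \<in> imag_units \<longleftrightarrow> J \<in> imag_units" for J
    using z(2) by (cases "Im z > 0") auto
  have T: "slice_emb J z \<in> ?T \<longleftrightarrow> J \<in> V" for J
    using z(2) by (simp add: slice_emb_def)
  have "open ?T"
    using rep z(2) unfolding stem_rep_def by (intro open_vimage continuous_intros) auto
  have pS: "?p \<in> qsphere ?p"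
    unfolding qsphere_def sphere
    using I(1) z(2) sgn[of "sgn (Im z) *\<^sub>R I"]
    by (auto intro!: exI[of _ "sgn (Im z) *\<^sub>R I"] simp: sgn sgn_mult_self_eq)
  show ?thesis
    unfolding spherical_coeffs_def
  proof (intro exI[of _ "qsphere ?p \<inter> ?T"] conjI ballI impI)
    show "openin (top_of_set (qsphere ?p)) (qsphere ?p \<inter> ?T)"
      using \<open>open ?T\<close> by blast
    show "?p \<in> qsphere ?p \<inter> ?T" using pS T I by blast
    show "qsphere ?p \<inter> ?T \<subseteq> \<Omega>"
    proof
      fix q assume q: "q \<in> qsphere ?p \<inter> ?T"
      then obtain J where J: "J \<in> imag_units" "q = slice_emb (sgn (Im z) *\<^sub>R J) z"
        unfolding qsphere_def sphere by blast
      with q have "sgn (Im z) *\<^sub>R J \<in> V \<inter> imag_units" using T sgn by blast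
      then show "q \<in> \<Omega>" using rep z J unfolding stem_rep_def by blast
    qed
    fix J assume J: "J \<in> imag_units" and "of_real (qre ?p) + norm (qim ?p) *\<^sub>R J \<in> qsphere ?p \<inter> ?T"
    then have "sgn (Im z) *\<^sub>R J \<in> V \<inter> imag_units" unfolding sphere using T sgn J by blast
    then have "f (slice_emb (sgn (Im z) *\<^sub>R J) z) = b z + (sgn (Im z) *\<^sub>R J) * c z"
      using rep z unfolding stem_rep_def by blast
    then show "f (of_real (qre ?p) + norm (qim ?p) *\<^sub>R J) = b z + J * (sgn (Im z) *\<^sub>R c z)"
      unfolding sphere by simp
  qed
qed

text \<open>A stem computes the spherical value and the spherical derivative. The sign of \<open>Im z\<close>
  cancels in the latter.\<close>

lemma stem_rep_spherical:
  assumes rep: "stem_rep \<Omega> f D V b c" and I: "I \<in> imag_units" "I \<in> V" and z: "z \<in> D" "Im z \<noteq> 0"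
  shows "spherical_value \<Omega> f (slice_emb I z) = b z"
    "spherical_deriv \<Omega> f (slice_emb I z) = c z /\<^sub>R Im z"
proof -
  let ?p = "slice_emb I z"
  have p: "?p \<notin> \<real>" using z slice_emb_real_iff[OF I(1)] by blast
  note coeffs = stem_rep_spherical_coeffs[OF assms]
  have "(THE b. \<exists>c. spherical_coeffs \<Omega> f ?p b c) = b z"
    using coeffs spherical_coeffs_unique(1)[OF p] by (intro the_equality) blast+
  with p show "spherical_value \<Omega> f ?p = b z" by (simp add: spherical_value_def)
  have "(THE c. \<exists>b. spherical_coeffs \<Omega> f ?p b c) = sgn (Im z) *\<^sub>R c z"
    using coeffs spherical_coeffs_unique(2)[OF p] by (intro the_equality) blast+
  then have "spherical_deriv \<Omega> f ?p = (sgn (Im z) *\<^sub>R c z) /\<^sub>R \<bar>Im z\<bar>"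
    by (simp only: spherical_deriv_def slice_emb_components(3)[OF I(1)])
  also have "\<dots> = c z /\<^sub>R Im z"
    using z(2) by (cases "Im z > 0") (auto simp: sgn_if)
  finally show "spherical_deriv \<Omega> f ?p = c z /\<^sub>R Im z" .
qed

section \<open>The regular operations\<close>

text \<open>The regular product is the product of stems. This covers real points too, where the
  operation is defined separately, since \<open>c\<close> vanishes there.\<close>

lemma stem_rep_reg_mult:
  assumes f: "stem_rep \<Omega> f D V b c" and g: "stem_rep \<Omega> g D V b' c'"
  shows "stem_rep \<Omega> (reg_mult \<Omega> f g) D V
    (\<lambda>z. b z * b' z - c z * c' z) (\<lambda>z. b z * c' z + c z * b' z)"
proof -
  have "reg_mult \<Omega> f g (slice_emb I z) = b z * b' z - c z * c' z + I * (b z * c' z + c z * b' z)"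
    if z: "z \<in> D" and I: "I \<in> imag_units" "I \<in> V" for I z
  proof (cases "Im z = 0")
    case True
    then show ?thesis
      using stem_rep_apply[OF f I z] stem_rep_real[OF f I z] stem_rep_real[OF g I z] slice_emb_real_iff[OF I(1)]
      by (simp add: reg_mult_def)
  next
    case False
    have "reg_mult \<Omega> f g (slice_emb I z) = b z * b' z
        + (Im z *\<^sub>R I)\<^sup>2 * (c z /\<^sub>R Im z) * (c' z /\<^sub>R Im z)
        + (Im z *\<^sub>R I) * (b z * (c' z /\<^sub>R Im z) + (c z /\<^sub>R Im z) * b' z)"
      using stem_rep_apply(1)[OF f I z] slice_emb_real_iff[OF I(1)] False
      by (simp only: reg_mult_def restrict_apply' if_False slice_emb_components(2)[OF I(1)]
          stem_rep_spherical[OF f I z False] stem_rep_spherical[OF g I z False])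
    also have "(Im z *\<^sub>R I)\<^sup>2 * (c z /\<^sub>R Im z) * (c' z /\<^sub>R Im z) = - (c z * c' z)"
    proof -
      have "inverse (Im z) * (inverse (Im z) * (Im z * Im z)) = 1"
        using False by (simp add: field_simps)
      then show ?thesis using imag_unit_mult[OF I(1)] by (simp add: power2_eq_square)
    qed
    also have "(Im z *\<^sub>R I) * (b z * (c' z /\<^sub>R Im z) + (c z /\<^sub>R Im z) * b' z) = I * (b z * c' z + c z * b' z)"
      using False by (simp add: distrib_left scaleR_right_distrib)
    finally show ?thesis by simp
  qed
  then show ?thesis
    using f g stem_hol_mult[of D b c b' c'] unfolding stem_rep_def by auto
qed

lemma stem_rep_reg_conj:
  assumes f: "stem_rep \<Omega> f D V b c"
  shows "stem_rep \<Omega> (reg_conj \<Omega> f) D V (\<lambda>z. qconj (b z)) (\<lambda>z. qconj (c z))"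
proof -
  have "reg_conj \<Omega> f (slice_emb I z) = qconj (b z) + I * qconj (c z)"
    if z: "z \<in> D" and I: "I \<in> imag_units" "I \<in> V" for I z
  proof (cases "Im z = 0")
    case True
    then show ?thesis
      using stem_rep_apply[OF f I z] stem_rep_real[OF f I z] slice_emb_real_iff[OF I(1)]
      by (simp add: reg_conj_def)
  next
    case False
    then show ?thesis
      using stem_rep_apply(1)[OF f I z] slice_emb_real_iff[OF I(1)]
      by (simp add: reg_conj_def slice_emb_components(2)[OF I(1)] stem_rep_spherical[OF f I z False])
  qed
  then show ?thesis
    using f stem_hol_qconj[of D b c] unfolding stem_rep_def by auto
qed

text \<open>The stem of the symmetrization is real-valued; it is written here as the product of the
  stem \<open>(b, c)\<close> with its conjugate, whose Cauchy--Riemann equations are already known.\<close>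

lemma stem_rep_symmetrization:
  assumes f: "stem_rep \<Omega> f D V b c"
  shows "stem_rep \<Omega> (symmetrization \<Omega> f) D V
    (\<lambda>z. b z * qconj (b z) - c z * qconj (c z)) (\<lambda>z. b z * qconj (c z) + c z * qconj (b z))"
proof -
  have "symmetrization \<Omega> f (slice_emb I z) =
      b z * qconj (b z) - c z * qconj (c z) + I * (b z * qconj (c z) + c z * qconj (b z))"
    if z: "z \<in> D" and I: "I \<in> imag_units" "I \<in> V" for I z
  proof (cases "Im z = 0")
    case True
    then show ?thesis
      using stem_rep_apply[OF f I z] stem_rep_real[OF f I z] slice_emb_real_iff[OF I(1)]
      by (simp add: symmetrization_def mult_qconj_self)
  next
    case False
    have "norm I = 1" using I by (simp add: imag_unit_iff)
    have "symmetrization \<Omega> f (slice_emb I z) = of_real ((norm (b z))\<^sup>2)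
        - of_real ((norm ((Im z *\<^sub>R I) * (c z /\<^sub>R Im z)))\<^sup>2)
        + 2 * (Im z *\<^sub>R I) * of_real (qre (b z * qconj (c z /\<^sub>R Im z)))"
      using stem_rep_apply(1)[OF f I z] slice_emb_real_iff[OF I(1)] False
      by (simp only: symmetrization_def restrict_apply' if_False slice_emb_components(2)[OF I(1)]
          stem_rep_spherical[OF f I z False])
    also have "norm ((Im z *\<^sub>R I) * (c z /\<^sub>R Im z)) = norm (c z)"
      using False \<open>norm I = 1\<close> by (simp add: norm_mult)
    also have "2 * (Im z *\<^sub>R I) * of_real (qre (b z * qconj (c z /\<^sub>R Im z)))
        = I * of_real (2 * qre (b z * qconj (c z)))"
    proof -
      have "qre (b z * qconj (c z /\<^sub>R Im z)) = qre (b z * qconj (c z)) / Im z"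
        by (simp add: divide_inverse algebra_simps)
      moreover have "2 * (Im z *\<^sub>R I) = (2 * Im z) *\<^sub>R I"
        by (metis mult_2 scaleR_2 scaleR_scaleR)
      ultimately show ?thesis using False by (simp add: of_real_def)
    qed
    also have "of_real (2 * qre (b z * qconj (c z))) = b z * qconj (c z) + c z * qconj (b z)"
      using quat_sel_of_real[of 2] by (simp add: quat_eq_iff algebra_simps)
    finally show ?thesis by (simp only: mult_qconj_self)
  qed
  then show ?thesis
    using f stem_hol_mult[of D b c, OF _ stem_hol_qconj[of D b c]] unfolding stem_rep_def by auto
qed

lemma slice_regular_reg_mult:
  assumes \<Omega>: "slice_domain \<Omega>" and f: "slice_regular \<Omega> f" and g: "slice_regular \<Omega> g"
  shows "slice_regular \<Omega> (reg_mult \<Omega> f g)"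
proof (rule slice_regular_stemI[OF slice_domain_open[OF \<Omega>]])
  fix I z assume I: "I \<in> imag_units" and z: "slice_emb I z \<in> \<Omega>"
  obtain D V b c where 1: "stem_rep \<Omega> f D V b c" "z \<in> D" "I \<in> V"
    using slice_regular_stem_rep[OF \<Omega> f I z] .
  obtain D' V' b' c' where 2: "stem_rep \<Omega> g D' V' b' c'" "z \<in> D'" "I \<in> V'"
    using slice_regular_stem_rep[OF \<Omega> g I z] .
  have "stem_rep \<Omega> f (D \<inter> D') (V \<inter> V') b c"
    using 1 2 by (intro stem_rep_restrict) (auto simp: stem_rep_def)
  moreover have "stem_rep \<Omega> g (D \<inter> D') (V \<inter> V') b' c'"
    using stem_rep_restrict[OF 2(1), of D V] 1 by (simp add: stem_rep_def Int_commute)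
  ultimately have "stem_rep \<Omega> (reg_mult \<Omega> f g) (D \<inter> D') (V \<inter> V')
      (\<lambda>z. b z * b' z - c z * c' z) (\<lambda>z. b z * c' z + c z * b' z)"
    by (rule stem_rep_reg_mult)
  moreover have "z \<in> D \<inter> D'" "I \<in> V \<inter> V'" using 1 2 by auto
  ultimately show "\<exists>D V b c. stem_rep \<Omega> (reg_mult \<Omega> f g) D V b c \<and> z \<in> D \<and> I \<in> V"
    by (intro exI conjI)
qed

lemma slice_regular_reg_conj:
  assumes \<Omega>: "slice_domain \<Omega>" and f: "slice_regular \<Omega> f"
  shows "slice_regular \<Omega> (reg_conj \<Omega> f)"
proof (rule slice_regular_stemI[OF slice_domain_open[OF \<Omega>]])
  fix I z assume I: "I \<in> imag_units" and z: "slice_emb I z \<in> \<Omega>"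
  obtain D V b c where rep: "stem_rep \<Omega> f D V b c" and zI: "z \<in> D" "I \<in> V"
    using slice_regular_stem_rep[OF \<Omega> f I z] .
  show "\<exists>D V b c. stem_rep \<Omega> (reg_conj \<Omega> f) D V b c \<and> z \<in> D \<and> I \<in> V"
    by (intro exI conjI) (rule stem_rep_reg_conj[OF rep] zI)+
qed

lemma slice_regular_symmetrization:
  assumes \<Omega>: "slice_domain \<Omega>" and f: "slice_regular \<Omega> f"
  shows "slice_regular \<Omega> (symmetrization \<Omega> f)"
proof (rule slice_regular_stemI[OF slice_domain_open[OF \<Omega>]])
  fix I z assume I: "I \<in> imag_units" and z: "slice_emb I z \<in> \<Omega>"
  obtain D V b c where rep: "stem_rep \<Omega> f D V b c" and zI: "z \<in> D" "I \<in> V"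
    using slice_regular_stem_rep[OF \<Omega> f I z] .
  show "\<exists>D V b c. stem_rep \<Omega> (symmetrization \<Omega> f) D V b c \<and> z \<in> D \<and> I \<in> V"
    by (intro exI conjI) (rule stem_rep_symmetrization[OF rep] zI)+
qed

lemma reg_ops_real:
  assumes "of_real x \<in> \<Omega>"
  shows "reg_mult \<Omega> f g (of_real x) = f (of_real x) * g (of_real x)"
    "reg_conj \<Omega> f (of_real x) = qconj (f (of_real x))"
    "symmetrization \<Omega> f (of_real x) = f (of_real x) * qconj (f (of_real x))"
  using assms by (simp_all add: reg_mult_def reg_conj_def symmetrization_def mult_qconj_self)

lemma reg_mult_slice_preserving:
  assumes \<Omega>: "slice_domain \<Omega>" and f: "slice_regular \<Omega> f" and g: "slice_regular \<Omega> g"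
    and pres: "slice_preserving \<Omega> f" and q: "q \<in> \<Omega>"
  shows "reg_mult \<Omega> f g q = f q * g q" "reg_mult \<Omega> g f q = f q * g q"
proof -
  note reg = slice_regular_reg_mult[OF \<Omega>] slice_regular_mult[OF slice_domain_open[OF \<Omega>] f g pres]
  show "reg_mult \<Omega> f g q = f q * g q"
    by (rule slice_regular_identity[OF \<Omega> _ _ _ q]) (auto intro: reg f g simp: reg_ops_real)
  show "reg_mult \<Omega> g f q = f q * g q"
    by (rule slice_regular_identity[OF \<Omega> _ _ _ q])
      (auto intro: reg f g simp: reg_ops_real Reals_quat_commute[OF slice_preserving_real[OF pres]])
qed

lemma reg_mult_const:
  assumes \<Omega>: "slice_domain \<Omega>" and f: "slice_regular \<Omega> f" and g: "slice_regular \<Omega> g"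
    and const: "\<forall>q\<in>\<Omega>. g q = c" and q: "q \<in> \<Omega>"
  shows "reg_mult \<Omega> f g q = f q * c"
  using const
  by (intro slice_regular_identity[OF \<Omega> slice_regular_reg_mult[OF \<Omega> f g]
        slice_regular_mult_right[OF slice_domain_open[OF \<Omega>] f] _ q]) (simp add: reg_ops_real)

lemma symmetrization_slice_preserving: "slice_preserving \<Omega> (symmetrization \<Omega> f)"
  unfolding slice_preserving_def
proof (intro ballI subsetI)
  fix I w assume I: "I \<in> imag_units" and "w \<in> symmetrization \<Omega> f ` (\<Omega> \<inter> cslice I)"
  then obtain q where q: "q \<in> \<Omega>" "q \<in> cslice I" "w = symmetrization \<Omega> f q" by blast
  then obtain z where z: "q = slice_emb I z"
    by (auto simp: cslice_def slice_emb_def intro: that[of "Complex _ _"])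
  have "\<exists>a b. w = of_real a + b *\<^sub>R I"
  proof (cases "q \<in> \<real>")
    case True
    then show ?thesis using q
      by (intro exI[of _ "(norm (f q))\<^sup>2"] exI[of _ 0]) (simp add: symmetrization_def)
  next
    case False
    define r where "r = qre (spherical_value \<Omega> f q * qconj (spherical_deriv \<Omega> f q))"
    define s where "s = (norm (spherical_value \<Omega> f q))\<^sup>2 - (norm (qim q * spherical_deriv \<Omega> f q))\<^sup>2"
    have "w = of_real s + 2 * qim q * of_real r"
      using q False by (simp only: symmetrization_def restrict_apply' if_False r_def s_def of_real_diff)
    also have "2 * qim q = (2 * Im z) *\<^sub>R I"
      unfolding z slice_emb_components(2)[OF I] by (metis mult_2 scaleR_2 scaleR_scaleR)
    also have "(2 * Im z) *\<^sub>R I * of_real r = (r * (2 * Im z)) *\<^sub>R I"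
      by (simp add: of_real_def)
    finally show ?thesis by blast
  qed
  then show "w \<in> cslice I" by (auto simp: cslice_def)
qed

lemma symmetrization_eq:
  assumes \<Omega>: "slice_domain \<Omega>" and f: "slice_regular \<Omega> f" and q: "q \<in> \<Omega>"
  shows "symmetrization \<Omega> f q = reg_mult \<Omega> f (reg_conj \<Omega> f) q"
    "symmetrization \<Omega> f q = reg_mult \<Omega> (reg_conj \<Omega> f) f q"
  by (rule slice_regular_identity[OF \<Omega> slice_regular_symmetrization[OF \<Omega> f]
        slice_regular_reg_mult[OF \<Omega>] _ q];
      simp add: f slice_regular_reg_conj[OF \<Omega>] reg_ops_real mult_qconj_self)+

section \<open>The real star-algebra of slice regular functions\<close>

lemma cring_real_ring: "cring real_ring"
proof (rule cringI)
  show "abelian_group real_ring"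
  proof (rule abelian_groupI)
    show "\<exists>y\<in>carrier real_ring. y \<oplus>\<^bsub>real_ring\<^esub> x = \<zero>\<^bsub>real_ring\<^esub>" for x
      by (auto simp: real_ring_def intro: exI[of _ "- x"])
  qed (auto simp: real_ring_def)
  show "comm_monoid real_ring"
    by (rule comm_monoidI) (auto simp: real_ring_def)
qed (auto simp: real_ring_def algebra_simps)

text \<open>Both sides of every axiom are slice regular, so it suffices to compare them on the real
  axis, where the operations are those of the quaternions.\<close>

lemma slice_regular_star_algebra:
  assumes \<Omega>: "slice_domain \<Omega>"
  shows "real_star_algebra (slice_regular_algebra \<Omega>) (reg_conj \<Omega>)"
proof -
  let ?A = "slice_regular_algebra \<Omega>"
  note op = slice_domain_open[OF \<Omega>]
  have sel: "carrier ?A = {f \<in> extensional \<Omega>. slice_regular \<Omega> f}"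
    "mult ?A = reg_mult \<Omega>" "one ?A = (\<lambda>q\<in>\<Omega>. 1)" "zero ?A = (\<lambda>q\<in>\<Omega>. 0)"
    "add ?A = (\<lambda>f g. \<lambda>q\<in>\<Omega>. f q + g q)" "smult ?A = (\<lambda>a f. \<lambda>q\<in>\<Omega>. a *\<^sub>R f q)"
    by (simp_all add: slice_regular_algebra_def)
  have closed: "\<And>f g. f \<in> carrier ?A \<Longrightarrow> g \<in> carrier ?A \<Longrightarrow> f \<otimes>\<^bsub>?A\<^esub> g \<in> carrier ?A"
    "\<And>f g. f \<in> carrier ?A \<Longrightarrow> g \<in> carrier ?A \<Longrightarrow> f \<oplus>\<^bsub>?A\<^esub> g \<in> carrier ?A"
    "\<And>a f. f \<in> carrier ?A \<Longrightarrow> a \<odot>\<^bsub>?A\<^esub> f \<in> carrier ?A"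
    "\<And>f. f \<in> carrier ?A \<Longrightarrow> reg_conj \<Omega> f \<in> carrier ?A"
    "\<one>\<^bsub>?A\<^esub> \<in> carrier ?A" "\<zero>\<^bsub>?A\<^esub> \<in> carrier ?A"
    unfolding sel
    using slice_regular_reg_mult[OF \<Omega>] slice_regular_reg_conj[OF \<Omega>]
    by (auto simp: slice_regular_restrict[OF op] slice_regular_add[OF op]
        slice_regular_scaleR[OF op] slice_regular_const[OF op])
      (simp_all add: reg_mult_def reg_conj_def)
  have eqI: "f = g" if "f \<in> carrier ?A" "g \<in> carrier ?A"
    "\<And>x. of_real x \<in> \<Omega> \<Longrightarrow> f (of_real x) = g (of_real x)" for f g
    using that by (intro slice_regular_ext[OF \<Omega>]) (auto simp: sel)
  have real: "\<And>f g x. of_real x \<in> \<Omega> \<Longrightarrow> (f \<otimes>\<^bsub>?A\<^esub> g) (of_real x) = f (of_real x) * g (of_real x)"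
    "\<And>f g x. of_real x \<in> \<Omega> \<Longrightarrow> (f \<oplus>\<^bsub>?A\<^esub> g) (of_real x) = f (of_real x) + g (of_real x)"
    "\<And>a f x. of_real x \<in> \<Omega> \<Longrightarrow> (a \<odot>\<^bsub>?A\<^esub> f) (of_real x) = a *\<^sub>R f (of_real x)"
    "\<And>f x. of_real x \<in> \<Omega> \<Longrightarrow> reg_conj \<Omega> f (of_real x) = qconj (f (of_real x))"
    "\<And>x. of_real x \<in> \<Omega> \<Longrightarrow> \<one>\<^bsub>?A\<^esub> (of_real x) = 1"
    "\<And>x. of_real x \<in> \<Omega> \<Longrightarrow> \<zero>\<^bsub>?A\<^esub> (of_real x) = 0"
    by (simp_all add: sel reg_ops_real)
  have group: "abelian_group ?A"
  proof (rule abelian_groupI)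
    fix f assume f: "f \<in> carrier ?A"
    have "((-1) \<odot>\<^bsub>?A\<^esub> f) \<oplus>\<^bsub>?A\<^esub> f = \<zero>\<^bsub>?A\<^esub>"
      by (rule eqI) (simp_all add: closed f real)
    then show "\<exists>g\<in>carrier ?A. g \<oplus>\<^bsub>?A\<^esub> f = \<zero>\<^bsub>?A\<^esub>" using closed(3)[OF f] by blast
  qed (auto intro!: eqI simp: closed real)
  show ?thesis
  proof (rule real_star_algebra.intro)
    show "ring ?A"
    proof (rule ringI[OF group])
      show "monoid ?A" by (rule monoidI) (auto intro!: eqI simp: closed real mult.assoc)
    qed (auto intro!: eqI simp: closed real algebra_simps)
    show "module real_ring ?A"
      by (rule moduleI[OF cring_real_ring group])
        (auto intro!: eqI simp: closed real algebra_simps, auto simp: real_ring_def algebra_simps)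
  qed (auto intro!: eqI simp: closed real qconj_mult quat_eq_iff)
qed

theorem theorem4p3:
  fixes \<Omega> :: "quat set"
  assumes "slice_domain \<Omega>"
  shows "real_star_algebra (slice_regular_algebra \<Omega>) (reg_conj \<Omega>) \<and>
    (\<forall>f g. slice_regular \<Omega> f \<longrightarrow> slice_regular \<Omega> g \<longrightarrow>
      (slice_preserving \<Omega> f \<longrightarrow>
        (\<forall>q\<in>\<Omega>. reg_mult \<Omega> f g q = f q * g q \<and> f q * g q = reg_mult \<Omega> g f q)) \<and>
      (\<forall>c. (\<forall>q\<in>\<Omega>. g q = c) \<longrightarrow> (\<forall>q\<in>\<Omega>. reg_mult \<Omega> f g q = f q * c)) \<and>
      slice_preserving \<Omega> (symmetrization \<Omega> f) \<and>
      slice_regular \<Omega> (symmetrization \<Omega> f) \<and>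
      (\<forall>q\<in>\<Omega>. symmetrization \<Omega> f q = reg_mult \<Omega> f (reg_conj \<Omega> f) q \<and>
              symmetrization \<Omega> f q = reg_mult \<Omega> (reg_conj \<Omega> f) f q))"
proof (intro conjI allI impI ballI)
  fix f g q assume f: "slice_regular \<Omega> f" and g: "slice_regular \<Omega> g"
  show "reg_mult \<Omega> f g q = f q * g q" "f q * g q = reg_mult \<Omega> g f q"
    if "slice_preserving \<Omega> f" "q \<in> \<Omega>"
    using reg_mult_slice_preserving[OF assms f g that] by simp_all
  show "reg_mult \<Omega> f g q = f q * c" if "\<forall>q\<in>\<Omega>. g q = c" "q \<in> \<Omega>" for c
    using reg_mult_const[OF assms f g that] .
  show "slice_regular \<Omega> (symmetrization \<Omega> f)"
    using slice_regular_symmetrization[OF assms f] .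
  show "symmetrization \<Omega> f q = reg_mult \<Omega> f (reg_conj \<Omega> f) q"
    "symmetrization \<Omega> f q = reg_mult \<Omega> (reg_conj \<Omega> f) f q" if "q \<in> \<Omega>"
    using symmetrization_eq[OF assms f that] .
qed (use slice_regular_star_algebra[OF assms] symmetrization_slice_preserving in blast)+

end
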